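(* Let $k$ be a field of characteristic $0$ and let $\mathfrak a$ be the two-dimensional abelian Lie algebra over $k$. For any $n\ge2$, the derived Harish-Chandra homomorphism $$\Phi_{\mathfrak g}:\mathrm{DRep}_{\mathfrak g}(\mathfrak a)^G\to\mathbf{Sym}(\mathfrak h^*\oplus\mathfrak h^*\oplus\mathfrak h^*[1])^W$$ is a quasi-isomorphism for $\mathfrak g=\mathfrak{sl}_n$ if and only if it is a quasi-isomorphism for $\mathfrak g=\mathfrak{gl}_n$.
   Context: For a finite-dimensional reductive Lie algebra $\mathfrak g$ over $k$ with reductive group $G$, Cartan subalgebra $\mathfrak h$ and Weyl group $W$ (for $\mathfrak{gl}_n$, $\mathfrak{sl}_n$: $\mathfrak h$ the diagonal, resp. traceless diagonal, matrices and $W=S_n$), the derived scheme $\mathrm{DRep}_{\mathfrak g}(\mathfrak a)^G$ is represented by the commutative DG algebra $(k[\mathfrak g\times\mathfrak g]\otimes\wedge\mathfrak g^*,d)^G$, where $k[\mathfrak g\times\mathfrak g]$ is in homological degree $0$, $\mathfrak g^*\subset\wedge\mathfrak g^*$ is in homological degree $1$, $d$ is the derivation with $d\varphi(\xi,\eta)=\varphi([\xi,\eta])$ for $\varphi\in\mathfrak g^*$, $\xi,\eta\in\mathfrak g$, and $G$ acts diagonally via the adjoint action. The target $\mathbf{Sym}(\mathfrak h^*\oplus\mathfrak h^*\oplus\mathfrak h^*[1])^W$ (graded symmetric algebra, $\mathfrak h^*[1]$ in degree $1$, zero differential) is $(k[\mathfrak h\times\mathfrak h]\otimes\wedge\mathfrak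 h^* )^W$ with diagonal $W$-action, and $\Phi_{\mathfrak g}$ is given by restriction of functions from $\mathfrak g$ to $\mathfrak h$. *)

theory Defs
  imports "HOL-Analysis.Analysis" "HOL-Library.Function_Algebras"
begin

section \<open>Quasi-isomorphisms of non-negatively graded chain complexes\<close>

text \<open>
  A complex consists of subgroups \<open>C p\<close> of one ambient abelian group, for \<open>p\<close> a natural number,
  and a differential \<open>d\<close> with \<open>d (C (Suc p)) \<subseteq> C p\<close> which vanishes on \<open>C 0\<close>. Homology classes are
  cosets of the group of boundaries.
\<close>

definition cycles :: "(nat \<Rightarrow> 'a::ab_group_add set) \<Rightarrow> ('a \<Rightarrow> 'a) \<Rightarrow> nat \<Rightarrow> 'a set" where
  "cycles C d p = {z \<in> C p. d z = 0}"

definition boundaries :: "(nat \<Rightarrow> 'a::ab_group_add set) \<Rightarrow> ('a \<Rightarrow> 'a) \<Rightarrow> nat \<Rightarrow> 'a set" where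
  "boundaries C d p = d ` C (Suc p)"

definition hclass :: "(nat \<Rightarrow> 'a::ab_group_add set) \<Rightarrow> ('a \<Rightarrow> 'a) \<Rightarrow> nat \<Rightarrow> 'a \<Rightarrow> 'a set" where
  "hclass C d p z = {z + b | b. b \<in> boundaries C d p}"

definition homology :: "(nat \<Rightarrow> 'a::ab_group_add set) \<Rightarrow> ('a \<Rightarrow> 'a) \<Rightarrow> nat \<Rightarrow> 'a set set" where
  "homology C d p = hclass C d p ` cycles C d p"

text \<open>For a chain map \<open>f\<close> the union below is the single coset \<open>hclass C' d' p (f z)\<close>, for any \<open>z \<in> c\<close>.\<close>

definition induced ::
  "(nat \<Rightarrow> 'b::ab_group_add set) \<Rightarrow> ('b \<Rightarrow> 'b) \<Rightarrow> ('a \<Rightarrow> 'b) \<Rightarrow> nat \<Rightarrow> 'a set \<Rightarrow> 'b set" where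
  "induced C' d' f p c = (\<Union>z\<in>c. hclass C' d' p (f z))"

definition chain_map ::
  "(nat \<Rightarrow> 'a::ab_group_add set) \<Rightarrow> ('a \<Rightarrow> 'a) \<Rightarrow>
   (nat \<Rightarrow> 'b::ab_group_add set) \<Rightarrow> ('b \<Rightarrow> 'b) \<Rightarrow> ('a \<Rightarrow> 'b) \<Rightarrow> bool" where
  "chain_map C d C' d' f \<longleftrightarrow>
     (\<forall>p. \<forall>x\<in>C p. f x \<in> C' p \<and> f (d x) = d' (f x)) \<and>
     (\<forall>p. \<forall>x\<in>C p. \<forall>y\<in>C p. f (x + y) = f x + f y)"

definition quasi_iso ::
  "(nat \<Rightarrow> 'a::ab_group_add set) \<Rightarrow> ('a \<Rightarrow> 'a) \<Rightarrow>
   (nat \<Rightarrow> 'b::ab_group_add set) \<Rightarrow> ('b \<Rightarrow> 'b) \<Rightarrow> ('a \<Rightarrow> 'b) \<Rightarrow> bool" where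
  "quasi_iso C d C' d' f \<longleftrightarrow>
     chain_map C d C' d' f \<and>
     (\<forall>p. bij_betw (induced C' d' f p) (homology C d p) (homology C' d' p))"


section \<open>The graded commutative algebra of a space of matrices\<close>

text \<open>
  For a linear space \<open>V\<close> of matrices over an infinite field, an element of \<open>k[V \<times> V] \<otimes> \<And>V\<^sup>*\<close> is
  identified with a function \<open>\<omega> \<xi> \<eta> vs\<close>: its component of homological degree \<open>p\<close> is the restriction
  to lists \<open>vs\<close> of length \<open>p\<close>, which is polynomial in \<open>(\<xi>, \<eta>) \<in> V \<times> V\<close> and an alternating
  \<open>p\<close>-linear form in \<open>vs\<close>. Functions on \<open>V\<close> are extended by zero outside \<open>V\<close>.
\<close>

type_synonym ('k, 'n) matrices = "'k^'n^'n"
type_synonym ('k, 'n) superfun =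
  "('k, 'n) matrices \<Rightarrow> ('k, 'n) matrices \<Rightarrow> ('k, 'n) matrices list \<Rightarrow> 'k"

definition mscale :: "'k::field \<Rightarrow> ('k, 'n::finite) matrices \<Rightarrow> ('k, 'n) matrices" where
  "mscale c A = (\<chi> i j. c * A $ i $ j)"

definition dual :: "('k::field, 'n::finite) matrices set \<Rightarrow> (('k, 'n) matrices \<Rightarrow> 'k) set" where
  "dual V = {\<phi>. (\<forall>x\<in>V. \<forall>y\<in>V. \<phi> (x + y) = \<phi> x + \<phi> y) \<and>
                (\<forall>c. \<forall>x\<in>V. \<phi> (mscale c x) = c * \<phi> x) \<and>
                (\<forall>x. x \<notin> V \<longrightarrow> \<phi> x = 0)}"

definition restr ::
  "('k::field, 'n::finite) matrices set \<Rightarrow> ('k, 'n) superfun \<Rightarrow> ('k, 'n) superfun" where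
  "restr V \<omega> = (\<lambda>\<xi> \<eta> vs. if \<xi> \<in> V \<and> \<eta> \<in> V \<and> set vs \<subseteq> V then \<omega> \<xi> \<eta> vs else 0)"

definition hom_degree :: "nat \<Rightarrow> ('k::field, 'n::finite) superfun \<Rightarrow> bool" where
  "hom_degree p \<omega> \<longleftrightarrow> (\<forall>\<xi> \<eta> vs. length vs \<noteq> p \<longrightarrow> \<omega> \<xi> \<eta> vs = 0)"

text \<open>
  The product is pointwise in \<open>(\<xi>, \<eta>)\<close> and the wedge product of alternating forms in \<open>vs\<close>: the sum
  runs over all ways of distributing the arguments to the two factors, with the sign of the
  corresponding shuffle, so that \<open>(\<phi> \<and> \<psi>)(v, w) = \<phi>(v) \<psi>(w) - \<phi>(w) \<psi>(v)\<close> for \<open>\<phi>, \<psi> \<in> V\<^sup>*\<close>.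
\<close>

definition shuffle_sign :: "nat \<Rightarrow> nat set \<Rightarrow> 'k::field" where
  "shuffle_sign m I = (-1) ^ card {(i, j). i < j \<and> j < m \<and> i \<notin> I \<and> j \<in> I}"

definition super_prod ::
  "('k::field, 'n::finite) superfun \<Rightarrow> ('k, 'n) superfun \<Rightarrow> ('k, 'n) superfun" (infixl "\<odot>" 70) where
  "\<alpha> \<odot> \<beta> = (\<lambda>\<xi> \<eta> vs. \<Sum>I\<in>Pow {..<length vs}.
      shuffle_sign (length vs) I * \<alpha> \<xi> \<eta> (nths vs I) * \<beta> \<xi> \<eta> (nths vs (- I)))"

definition const_fun :: "('k::field, 'n::finite) matrices set \<Rightarrow> 'k \<Rightarrow> ('k, 'n) superfun" where
  "const_fun V c = restr V (\<lambda>\<xi> \<eta> vs. if vs = [] then c else 0)"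

definition fst_fun ::
  "('k::field, 'n::finite) matrices set \<Rightarrow> (('k, 'n) matrices \<Rightarrow> 'k) \<Rightarrow> ('k, 'n) superfun" where
  "fst_fun V \<phi> = restr V (\<lambda>\<xi> \<eta> vs. if vs = [] then \<phi> \<xi> else 0)"

definition snd_fun ::
  "('k::field, 'n::finite) matrices set \<Rightarrow> (('k, 'n) matrices \<Rightarrow> 'k) \<Rightarrow> ('k, 'n) superfun" where
  "snd_fun V \<phi> = restr V (\<lambda>\<xi> \<eta> vs. if vs = [] then \<phi> \<eta> else 0)"

definition odd_fun ::
  "('k::field, 'n::finite) matrices set \<Rightarrow> (('k, 'n) matrices \<Rightarrow> 'k) \<Rightarrow> ('k, 'n) superfun" where
  "odd_fun V \<phi> = restr V (\<lambda>\<xi> \<eta> vs. if length vs = 1 then \<phi> (hd vs) else 0)"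

text \<open>
  \<open>k[V \<times> V] \<otimes> \<And>V\<^sup>* = Sym (V\<^sup>* \<oplus> V\<^sup>* \<oplus> V\<^sup>*[1])\<close>: the algebra generated by two copies of \<open>V\<^sup>*\<close> in
  degree 0 (the linear functions of \<open>\<xi>\<close> and of \<open>\<eta>\<close>) and one copy of \<open>V\<^sup>*\<close> in degree 1.
\<close>

inductive_set superalg :: "('k::field, 'n::finite) matrices set \<Rightarrow> ('k, 'n) superfun set"
  for V :: "('k, 'n) matrices set" where
  const: "const_fun V c \<in> superalg V"
| fst: "\<phi> \<in> dual V \<Longrightarrow> fst_fun V \<phi> \<in> superalg V"
| snd: "\<phi> \<in> dual V \<Longrightarrow> snd_fun V \<phi> \<in> superalg V"
| odd: "\<phi> \<in> dual V \<Longrightarrow> odd_fun V \<phi> \<in> superalg V"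
| add: "\<lbrakk>\<alpha> \<in> superalg V; \<beta> \<in> superalg V\<rbrakk> \<Longrightarrow> \<alpha> + \<beta> \<in> superalg V"
| prod: "\<lbrakk>\<alpha> \<in> superalg V; \<beta> \<in> superalg V\<rbrakk> \<Longrightarrow> \<alpha> \<odot> \<beta> \<in> superalg V"

definition invariants ::
  "('k::field, 'n::finite) matrices set \<Rightarrow> (('k, 'n) matrices \<Rightarrow> ('k, 'n) matrices) set \<Rightarrow>
   nat \<Rightarrow> ('k, 'n) superfun set" where
  "invariants V T p = {\<omega> \<in> superalg V. hom_degree p \<omega> \<and>
     (\<forall>\<tau>\<in>T. \<forall>\<xi> \<eta> vs. \<omega> (\<tau> \<xi>) (\<tau> \<eta>) (map \<tau> vs) = \<omega> \<xi> \<eta> vs)}"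


section \<open>The differential\<close>

definition bracket ::
  "('k::field, 'n::finite) matrices \<Rightarrow> ('k, 'n) matrices \<Rightarrow> ('k, 'n) matrices" where
  "bracket x y = x ** y - y ** x"

text \<open>
  The derivation that vanishes in degree 0 and sends \<open>\<phi>\<close> in degree 1 to \<open>\<phi> [\<xi>, \<eta>]\<close> is the
  contraction of forms with \<open>[\<xi>, \<eta>]\<close>; the lemmas below verify these defining properties.
\<close>

definition differential :: "('k::field, 'n::finite) superfun \<Rightarrow> ('k, 'n) superfun" where
  "differential \<omega> = (\<lambda>\<xi> \<eta> vs. \<omega> \<xi> \<eta> (bracket \<xi> \<eta> # vs))"

definition parity :: "('k::field, 'n::finite) superfun \<Rightarrow> ('k, 'n) superfun" where
  "parity \<omega> = (\<lambda>\<xi> \<eta> vs. (-1) ^ length vs * \<omega> \<xi> \<eta> vs)"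

lemma differential_const: "differential (const_fun V c) = 0"
  by (auto simp: differential_def const_fun_def restr_def fun_eq_iff)

lemma differential_fst: "differential (fst_fun V \<phi>) = 0"
  by (auto simp: differential_def fst_fun_def restr_def fun_eq_iff)

lemma differential_snd: "differential (snd_fun V \<phi>) = 0"
  by (auto simp: differential_def snd_fun_def restr_def fun_eq_iff)

lemma differential_odd:
  assumes "\<And>x y. x \<in> V \<Longrightarrow> y \<in> V \<Longrightarrow> bracket x y \<in> V"
  shows "differential (odd_fun V \<phi>) =
    restr V (\<lambda>\<xi> \<eta> vs. if vs = [] then \<phi> (bracket \<xi> \<eta>) else 0)"
  using assms by (auto simp: differential_def odd_fun_def restr_def fun_eq_iff)

lemma differential_add: "differential (\<alpha> + \<beta>) = differential \<alpha> + differential \<beta>"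
  by (simp add: differential_def fun_eq_iff)

lemma shuffle_sign_insert: "shuffle_sign (Suc m) (insert 0 (Suc ` J)) = shuffle_sign m J"
proof -
  have "{(i, j). i < j \<and> j < Suc m \<and> i \<notin> insert 0 (Suc ` J) \<and> j \<in> insert 0 (Suc ` J)} =
      map_prod Suc Suc ` {(i, j). i < j \<and> j < m \<and> i \<notin> J \<and> j \<in> J}" (is "?A = _ ` ?B")
  proof (intro equalityI subsetI)
    fix x assume "x \<in> ?A"
    then obtain i j where x: "x = (i, Suc j)" "i < Suc j" "j < m" "i \<noteq> 0" "i \<notin> Suc ` J" "j \<in> J"
      by auto
    then obtain i' where "i = Suc i'" by (cases i) auto
    with x show "x \<in> map_prod Suc Suc ` ?B" by (auto simp: image_iff)
  qed auto
  then have "card ?A = card ?B"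
    by (simp only:) (intro card_image inj_onI, auto)
  then show ?thesis
    unfolding shuffle_sign_def by (simp only:)
qed

lemma shuffle_sign_shift:
  assumes "J \<subseteq> {..<m}"
  shows "shuffle_sign (Suc m) (Suc ` J) = (-1) ^ card J * shuffle_sign m J"
proof -
  let ?B = "{(i, j). i < j \<and> j < m \<and> i \<notin> J \<and> j \<in> J}"
  have fB: "finite ?B"
    by (rule finite_subset[of _ "{..<m} \<times> {..<m}"]) auto
  have fJ: "finite J" using assms finite_subset by blast
  have "{(i, j). i < j \<and> j < Suc m \<and> i \<notin> Suc ` J \<and> j \<in> Suc ` J} =
      map_prod Suc Suc ` ?B \<union> (\<lambda>j. (0, Suc j)) ` J" (is "?A = ?C")
  proof (intro equalityI subsetI)
    fix x assume "x \<in> ?A"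
    then obtain i j where x: "x = (i, Suc j)" "i < Suc j" "j < m" "i \<notin> Suc ` J" "j \<in> J"
      by auto
    then show "x \<in> ?C" by (cases i) (auto simp: image_iff)
  qed (use assms in auto)
  moreover have "card ?C = card ?B + card J"
    by (subst card_Un_disjoint)
      (auto simp: fB fJ card_image prod.inj_map inj_on_def)
  ultimately show ?thesis
    unfolding shuffle_sign_def by (simp add: power_add mult.commute)
qed

lemma Pow_lessThan_Suc_shift:
  "Pow {..<Suc m} = (\<lambda>J. insert 0 (Suc ` J)) ` Pow {..<m} \<union> (`) Suc ` Pow {..<m}"
proof -
  have "{..<Suc m} = insert 0 (Suc ` {..<m})"
    by (simp add: lessThan_Suc_eq_insert_0)
  then show ?thesis by (auto simp: Pow_insert image_Pow_surj image_image simp flip: image_Pow_surj)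
qed

lemma differential_prod:
  "differential (\<alpha> \<odot> \<beta>) = differential \<alpha> \<odot> \<beta> + parity \<alpha> \<odot> differential \<beta>"
proof (intro ext)
  fix \<xi> \<eta> :: "('a, 'b) matrices" and vs :: "('a, 'b) matrices list"
  let ?w = "bracket \<xi> \<eta>" and ?m = "length vs"
  let ?f = "\<lambda>I. shuffle_sign (Suc ?m) I * \<alpha> \<xi> \<eta> (nths (?w # vs) I) * \<beta> \<xi> \<eta> (nths (?w # vs) (- I))"
  have inj1: "inj_on (\<lambda>J. insert 0 (Suc ` J)) (Pow {..<?m})"
    by (intro inj_onI) (auto simp: set_eq_iff image_iff)
  have inj2: "inj_on ((`) Suc) (Pow {..<?m})"
    by (intro inj_onI) (auto simp: set_eq_iff image_iff)
  have "differential (\<alpha> \<odot> \<beta>) \<xi> \<eta> vs = sum ?f (Pow {..<Suc ?m})"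
    by (simp add: differential_def super_prod_def)
  also have "\<dots> = (\<Sum>J\<in>Pow {..<?m}. ?f (insert 0 (Suc ` J))) + (\<Sum>J\<in>Pow {..<?m}. ?f (Suc ` J))"
    unfolding Pow_lessThan_Suc_shift
    by (subst sum.union_disjoint) (auto simp: sum.reindex[OF inj1] sum.reindex[OF inj2])
  also have "(\<Sum>J\<in>Pow {..<?m}. ?f (insert 0 (Suc ` J))) = (differential \<alpha> \<odot> \<beta>) \<xi> \<eta> vs"
    unfolding super_prod_def
    by (intro sum.cong) (auto simp: differential_def shuffle_sign_insert nths_Cons Compl_eq
          image_iff intro!: arg_cong[of _ _ "nths vs"] arg_cong[of _ _ "\<beta> \<xi> \<eta>"])
  also have "(\<Sum>J\<in>Pow {..<?m}. ?f (Suc ` J)) = (parity \<alpha> \<odot> differential \<beta>) \<xi> \<eta> vs"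
    unfolding super_prod_def
  proof (intro sum.cong refl)
    fix J assume "J \<in> Pow {..<?m}"
    then have J: "J \<subseteq> {..<?m}" by simp
    then have "{i. i < ?m \<and> i \<in> J} = J" by auto
    then have len: "length (nths vs J) = card J" by (simp add: length_nths)
    have compl: "{j. Suc j \<in> - Suc ` J} = - J" "{j. Suc j \<in> Suc ` J} = J" by auto
    then show "?f (Suc ` J) = shuffle_sign ?m J * parity \<alpha> \<xi> \<eta> (nths vs J) *
        differential \<beta> \<xi> \<eta> (nths vs (- J))"
      unfolding nths_Cons compl differential_def parity_def shuffle_sign_shift[OF J] len
      by (simp add: ac_simps)
  qed
  finally show "differential (\<alpha> \<odot> \<beta>) \<xi> \<eta> vs =
      (differential \<alpha> \<odot> \<beta> + parity \<alpha> \<odot> differential \<beta>) \<xi> \<eta> vs"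
    by simp
qed

lemma differential_differential:
  assumes "\<omega> \<in> superalg V"
  shows "differential (differential \<omega>) = 0"
  using assms
proof induction
  case (odd \<phi>)
  then show ?case by (auto simp: differential_def odd_fun_def restr_def fun_eq_iff)
next
  case (prod \<alpha> \<beta>)
  have "differential (parity \<alpha>) = - parity (differential \<alpha>)"
    by (simp add: differential_def parity_def fun_eq_iff)
  moreover have "0 \<odot> \<beta> = 0" "parity (parity \<alpha>) \<odot> 0 = 0"
    by (simp_all add: super_prod_def fun_eq_iff)
  moreover have "(- \<gamma>) \<odot> \<delta> = - (\<gamma> \<odot> \<delta>)" for \<gamma> \<delta> :: "('a, 'b) superfun"
    by (simp add: super_prod_def fun_eq_iff sum_negf)
  ultimately show ?case
    by (simp only: differential_prod differential_add prod.IH add_0 add_0_right right_minus)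
next
  case (add \<alpha> \<beta>)
  show ?case by (simp only: differential_add add.IH add_0)
qed (simp_all add: differential_const differential_fst differential_snd,
    simp_all add: differential_def fun_eq_iff)


section \<open>The derived Harish-Chandra homomorphism\<close>

definition gl :: "('k::field, 'n::finite) matrices set" where
  "gl = UNIV"

definition sl :: "('k::field, 'n::finite) matrices set" where
  "sl = {A. trace A = 0}"

definition GL :: "('k::field, 'n::finite) matrices set" where
  "GL = {g. invertible g}"

definition SL :: "('k::field, 'n::finite) matrices set" where
  "SL = {g. det g = 1}"

definition cartan :: "('k::field, 'n::finite) matrices set \<Rightarrow> ('k, 'n) matrices set" where
  "cartan \<gg> = {A \<in> \<gg>. \<forall>i j. i \<noteq> j \<longrightarrow> A $ i $ j = 0}"

text \<open>
  As the field is infinite, the rational points of \<open>GL\<close> and \<open>SL\<close> are Zariski dense, so invariants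
  of the algebraic group are the same as invariants of its group of rational points.
\<close>

definition Ad ::
  "('k::field, 'n::finite) matrices set \<Rightarrow> (('k, 'n) matrices \<Rightarrow> ('k, 'n) matrices) set" where
  "Ad G = {\<lambda>x. g ** x ** matrix_inv g | g. g \<in> G}"

text \<open>The Weyl group \<open>S\<^sub>n\<close>, permuting the diagonal entries.\<close>

definition weyl :: "(('k::field, 'n::finite) matrices \<Rightarrow> ('k, 'n) matrices) set" where
  "weyl = {\<lambda>x. \<chi> i j. x $ \<sigma> i $ \<sigma> j | \<sigma>. bij \<sigma>}"

definition harish_chandra ::
  "('k::field, 'n::finite) matrices set \<Rightarrow> ('k, 'n) superfun \<Rightarrow> ('k, 'n) superfun" where
  "harish_chandra \<gg> = restr (cartan \<gg>)"

definition harish_chandra_quasi_iso ::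
  "('k::field, 'n::finite) matrices set \<Rightarrow> ('k, 'n) matrices set \<Rightarrow> bool" where
  "harish_chandra_quasi_iso \<gg> G \<longleftrightarrow>
     quasi_iso (invariants \<gg> (Ad G)) differential (invariants (cartan \<gg>) weyl) (\<lambda>_. 0)
       (harish_chandra \<gg>)"

end

theory Submission
  imports Defs
begin

text \<open>
  Splitting off the scalar matrices, \<open>gl\<^sub>n = sl\<^sub>n \<oplus> k\<cdot>1\<close>, exhibits the \<open>gl\<^sub>n\<close> complex and its Cartan
  counterpart as tensor products of the \<open>sl\<^sub>n\<close> complexes with \<open>Sym(k \<oplus> k \<oplus> k[1])\<close>, on which the
  differential vanishes, compatibly with restriction. Instead of tensor coefficients, the
  interpolation nodes of the two even scalar coordinates are used: \<open>\<omega>\<close> is recovered from finitely many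
  forms \<open>\<omega>(\<xi> + i, \<eta> + j)\<close> on \<open>sl\<^sub>n\<close> and from those of its contraction with the identity matrix, and
  these evaluations visibly respect invariants, differentials and restriction. Conversely the \<open>sl\<^sub>n\<close>
  map is a retract of the \<open>gl\<^sub>n\<close> map. Both steps need that forms invariant under \<open>SL\<^sub>n(k)\<close> are
  invariant under \<open>GL\<^sub>n(k)\<close>, although \<open>k\<close> need not contain \<open>n\<close>-th roots.
\<close>

section \<open>The algebra of superfunctions\<close>

text \<open>The target has zero differential, so a quasi-isomorphism amounts to two statements about
  elements: every invariant on the Cartan subalgebra is the restriction of a cycle, and every cycle
  that restricts to zero is a boundary. Such statements pass through a decomposition chosen
  separately for each element. The number of nodes may therefore depend on the form, and all that is
  used is that a form can be rebuilt from its slices. Chains are plain functions whose polynomiality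
  is known only through an inductive closure, so there are no coefficients to read off. Evaluation
  at a shifted point, in contrast, is an operation on functions, and it commutes with the
  differential because scalar matrices are central. Working with GL-invariants on both sides has two
  reasons: slices of forms on all matrices are invariant under conjugation by GL, and Weyl
  invariance of a restriction is read off from permutation matrices, whose determinant may be
  -1.\<close>

definition matspace :: "('k::field, 'n::finite) matrices set \<Rightarrow> bool" where
  "matspace V \<longleftrightarrow> 0 \<in> V \<and> (\<forall>x\<in>V. \<forall>y\<in>V. x + y \<in> V) \<and> (\<forall>c. \<forall>x\<in>V. mscale c x \<in> V)"

lemma matspace_zero: "matspace V \<Longrightarrow> 0 \<in> V"
  and matspace_add: "matspace V \<Longrightarrow> x \<in> V \<Longrightarrow> y \<in> V \<Longrightarrow> x + y \<in> V"
  and matspace_scale: "matspace V \<Longrightarrow> x \<in> V \<Longrightarrow> mscale c x \<in> V"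
  by (auto simp: matspace_def)

lemma mscale_nth [simp]: "mscale c x $ i $ j = c * x $ i $ j"
  by (simp add: mscale_def)

lemma mscale_simps [simp]: "mscale 0 x = 0" "mscale 1 x = x" "mscale c 0 = 0"
  by (simp_all add: vec_eq_iff)

lemma mscale_mscale [simp]: "mscale a (mscale b x) = mscale (a * b) x"
  by (simp add: vec_eq_iff)

lemma mscale_add_right: "mscale c (x + y) = mscale c x + mscale c y"
  and mscale_minus_left: "mscale (- a) x = - mscale a x"
  and mscale_minus_one: "mscale (-1) x = - x"
  by (simp_all add: vec_eq_iff algebra_simps)

lemma matspace_uminus: "matspace V \<Longrightarrow> x \<in> V \<Longrightarrow> - x \<in> V"
  by (metis mscale_minus_one matspace_scale)

lemma matspace_diff: "matspace V \<Longrightarrow> x \<in> V \<Longrightarrow> y \<in> V \<Longrightarrow> x - y \<in> V"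
  using matspace_add[of V x "- y"] by (simp add: matspace_uminus)

lemma dual_add: "\<phi> \<in> dual V \<Longrightarrow> x \<in> V \<Longrightarrow> y \<in> V \<Longrightarrow> \<phi> (x + y) = \<phi> x + \<phi> y"
  and dual_scale: "\<phi> \<in> dual V \<Longrightarrow> x \<in> V \<Longrightarrow> \<phi> (mscale c x) = c * \<phi> x"
  by (simp_all add: dual_def)

lemma super_prod_distrib_left: "(\<alpha> + \<beta>) \<odot> \<gamma> = \<alpha> \<odot> \<gamma> + \<beta> \<odot> \<gamma>"
  and super_prod_distrib_right: "\<alpha> \<odot> (\<beta> + \<gamma>) = \<alpha> \<odot> \<beta> + \<alpha> \<odot> \<gamma>"
  and super_prod_minus_left: "(- \<alpha>) \<odot> \<gamma> = - (\<alpha> \<odot> \<gamma>)"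
  and super_prod_minus_right: "\<alpha> \<odot> (- \<gamma>) = - (\<alpha> \<odot> \<gamma>)"
  by (auto simp: super_prod_def fun_eq_iff algebra_simps sum.distrib sum_negf)

lemma super_prod_zero [simp]: "0 \<odot> \<gamma> = 0" "\<gamma> \<odot> 0 = 0"
  by (auto simp: super_prod_def fun_eq_iff)

lemma super_prod_cong:
  assumes "\<And>us. set us \<subseteq> set vs \<Longrightarrow> \<alpha> \<xi> \<eta> us = \<alpha>' \<xi>' \<eta>' us"
    and "\<And>us. set us \<subseteq> set vs \<Longrightarrow> \<beta> \<xi> \<eta> us = \<beta>' \<xi>' \<eta>' us"
  shows "(\<alpha> \<odot> \<beta>) \<xi> \<eta> vs = (\<alpha>' \<odot> \<beta>') \<xi>' \<eta>' vs"
  unfolding super_prod_def by (intro sum.cong refl) (simp add: assms set_nths_subset)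

text \<open>The base point on the right is free because both factors there ignore theirs. A
  substitution in the odd arguments can thus be traded for a change of the two factors at one fixed
  point.\<close>

lemma super_prod_map:
  "(\<alpha> \<odot> \<beta>) \<xi> \<eta> (map f vs) =
    ((\<lambda>x y us. \<alpha> \<xi> \<eta> (map f us)) \<odot> (\<lambda>x y us. \<beta> \<xi> \<eta> (map f us))) \<xi>' \<eta>' vs"
  by (simp add: super_prod_def nths_map)

lemma set_nths_Un: "set (nths vs I) \<union> set (nths vs (- I)) = set vs"
proof
  show "set vs \<subseteq> set (nths vs I) \<union> set (nths vs (- I))"
  proof
    fix x assume "x \<in> set vs"
    then obtain i where "i < length vs" "x = vs ! i" by (metis in_set_conv_nth)
    then show "x \<in> set (nths vs I) \<union> set (nths vs (- I))"
      by (cases "i \<in> I") (auto simp: set_nths)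
  qed
qed (simp add: set_nths_subset)

lemma length_nths_add: "length (nths vs I) + length (nths vs (- I)) = length vs"
proof -
  have "{i. i < length vs} = {i. i < length vs \<and> i \<in> I} \<union> {i. i < length vs \<and> i \<in> - I}"
    by auto
  then have "card {i. i < length vs} =
      card ({i. i < length vs \<and> i \<in> I} \<union> {i. i < length vs \<and> i \<in> - I})"
    by (rule arg_cong)
  also have "\<dots> = card {i. i < length vs \<and> i \<in> I} + card {i. i < length vs \<and> i \<in> - I}"
    by (rule card_Un_disjoint) auto
  finally have "card {i. i < length vs} =
      card {i. i < length vs \<and> i \<in> I} + card {i. i < length vs \<and> i \<in> - I}" .
  then show ?thesis by (simp add: length_nths)
qed

lemma parity_prod: "parity (\<alpha> \<odot> \<beta>) = parity \<alpha> \<odot> parity \<beta>"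
proof (intro ext)
  fix \<xi> \<eta> :: "('a, 'b) matrices" and vs :: "('a, 'b) matrices list"
  have "(-1) ^ length vs = ((-1) ^ length (nths vs I) * (-1) ^ length (nths vs (- I)) :: 'a)" for I
    by (subst length_nths_add[of vs I, symmetric]) (rule power_add)
  then have "(-1) ^ length vs * (shuffle_sign (length vs) I * \<alpha> \<xi> \<eta> (nths vs I) * \<beta> \<xi> \<eta> (nths vs (- I))) =
      shuffle_sign (length vs) I * ((-1) ^ length (nths vs I) * \<alpha> \<xi> \<eta> (nths vs I)) *
      ((-1) ^ length (nths vs (- I)) * \<beta> \<xi> \<eta> (nths vs (- I)))" for I
    by (simp only: ac_simps)
  then show "parity (\<alpha> \<odot> \<beta>) \<xi> \<eta> vs = (parity \<alpha> \<odot> parity \<beta>) \<xi> \<eta> vs"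
    unfolding parity_def super_prod_def sum_distrib_left by (rule sum.cong[OF refl])
qed

lemma parity_add: "parity (\<alpha> + \<beta>) = parity \<alpha> + parity \<beta>"
  by (simp add: parity_def fun_eq_iff algebra_simps)

lemma parity_parity [simp]: "parity (parity \<alpha>) = \<alpha>"
proof -
  have "(-1) ^ n * ((-1) ^ n * c) = c" for n and c :: 'a
    by (cases "even n") simp_all
  then show ?thesis by (simp add: parity_def)
qed

text \<open>Every odd argument is handed to one of the two factors, so an argument outside
  \<open>V\<close> kills each summand of the shuffle sum; inside \<open>V\<close> both sides see the
  same values.\<close>

lemma restr_prod: "restr V (\<alpha> \<odot> \<beta>) = restr V \<alpha> \<odot> restr V \<beta>"
proof (intro ext)
  fix \<xi> \<eta> :: "('a, 'b) matrices" and vs :: "('a, 'b) matrices list"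
  show "restr V (\<alpha> \<odot> \<beta>) \<xi> \<eta> vs = (restr V \<alpha> \<odot> restr V \<beta>) \<xi> \<eta> vs"
  proof (cases "\<xi> \<in> V \<and> \<eta> \<in> V \<and> set vs \<subseteq> V")
    case True
    then show ?thesis
      by (subst restr_def, simp, intro super_prod_cong) (auto simp: restr_def)
  next
    case False
    then have 0: "restr V \<alpha> \<xi> \<eta> (nths vs I) * restr V \<beta> \<xi> \<eta> (nths vs (- I)) = 0" for I
      using set_nths_Un[of vs I] by (auto simp: restr_def)
    have "restr V (\<alpha> \<odot> \<beta>) \<xi> \<eta> vs = 0"
      using False by (auto simp: restr_def)
    then show ?thesis by (simp add: super_prod_def mult.assoc 0)
  qed
qed

lemma restr_add: "restr V (\<alpha> + \<beta>) = restr V \<alpha> + restr V \<beta>"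
  by (auto simp: restr_def fun_eq_iff)

lemma restr_restr: "restr V (restr U \<alpha>) = restr (V \<inter> U) \<alpha>"
  by (auto simp: restr_def fun_eq_iff)

lemma restr_superalg: "\<omega> \<in> superalg V \<Longrightarrow> restr V \<omega> = \<omega>"
  by (induction rule: superalg.induct)
    (simp_all add: const_fun_def fst_fun_def snd_fun_def odd_fun_def restr_restr restr_add restr_prod
      del: plus_fun_apply)

lemma superalg_outside:
  "\<omega> \<in> superalg V \<Longrightarrow> \<not> (\<xi> \<in> V \<and> \<eta> \<in> V \<and> set vs \<subseteq> V) \<Longrightarrow> \<omega> \<xi> \<eta> vs = 0"
  by (drule restr_superalg[symmetric], erule ssubst) (auto simp: restr_def)

lemma superalg_zero: "0 \<in> superalg V"
  using superalg.const[of V 0] by (simp add: const_fun_def restr_def zero_fun_def)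

text \<open>The coefficient \<open>g\<close> is an arbitrary function, so membership in
  \<open>superalg V\<close> is a separate matter; products of affine functions of the scalar
  coordinates are the case of interest.\<close>

definition scalar_fun ::
  "('k::field, 'n::finite) matrices set \<Rightarrow> (('k, 'n) matrices \<Rightarrow> ('k, 'n) matrices \<Rightarrow> 'k) \<Rightarrow>
   ('k, 'n) superfun" where
  "scalar_fun V g = restr V (\<lambda>\<xi> \<eta> vs. if vs = [] then g \<xi> \<eta> else 0)"

text \<open>A factor of homological degree 0 accepts no odd arguments, so only the summand with
  \<open>I = {}\<close> of the shuffle sum survives, and its sign is 1.\<close>

lemma scalar_fun_prod:
  assumes "restr V \<omega> = \<omega>" shows "scalar_fun V g \<odot> \<omega> = (\<lambda>\<xi> \<eta> vs. g \<xi> \<eta> * \<omega> \<xi> \<eta> vs)"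
proof -
  have "(\<lambda>\<xi> \<eta> vs. if vs = [] then g \<xi> \<eta> else 0) \<odot> \<omega> = (\<lambda>\<xi> \<eta> vs. g \<xi> \<eta> * \<omega> \<xi> \<eta> vs)"
  proof (intro ext)
    fix \<xi> \<eta> vs
    have "((\<lambda>\<xi> \<eta> vs. if vs = [] then g \<xi> \<eta> else 0) \<odot> \<omega>) \<xi> \<eta> vs =
      (\<Sum>I\<in>{{}}. shuffle_sign (length vs) I * (if nths vs I = [] then g \<xi> \<eta> else 0) *
         \<omega> \<xi> \<eta> (nths vs (- I)))"
      unfolding super_prod_def
    proof (intro sum.mono_neutral_right)
      show "\<forall>I\<in>Pow {..<length vs} - {{}}. shuffle_sign (length vs) I *
          (if nths vs I = [] then g \<xi> \<eta> else 0) * \<omega> \<xi> \<eta> (nths vs (- I)) = 0"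
      proof
        fix I assume "I \<in> Pow {..<length vs} - {{}}"
        then obtain i where "i \<in> I" "i < length vs" by auto
        then have "vs ! i \<in> set (nths vs I)" by (auto simp: set_nths)
        then have "nths vs I \<noteq> []" by force
        then show "shuffle_sign (length vs) I *
          (if nths vs I = [] then g \<xi> \<eta> else 0) * \<omega> \<xi> \<eta> (nths vs (- I)) = 0" by simp
      qed
    qed auto
    then show "((\<lambda>\<xi> \<eta> vs. if vs = [] then g \<xi> \<eta> else 0) \<odot> \<omega>) \<xi> \<eta> vs = g \<xi> \<eta> * \<omega> \<xi> \<eta> vs"
      by (simp add: shuffle_sign_def nths_all)
  qed
  then have "scalar_fun V g \<odot> \<omega> = restr V (\<lambda>\<xi> \<eta> vs. g \<xi> \<eta> * \<omega> \<xi> \<eta> vs)"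
    unfolding scalar_fun_def by (subst assms[symmetric]) (simp flip: restr_prod)
  also have "\<dots> = (\<lambda>\<xi> \<eta> vs. g \<xi> \<eta> * restr V \<omega> \<xi> \<eta> vs)"
    by (auto simp: restr_def fun_eq_iff)
  finally show ?thesis by (simp add: assms)
qed

lemma superalg_uminus:
  assumes "\<omega> \<in> superalg V" shows "- \<omega> \<in> superalg V"
proof -
  have "- \<omega> = const_fun V (-1) \<odot> \<omega>"
    using scalar_fun_prod[OF restr_superalg[OF assms], of "\<lambda>_ _. -1"]
    by (simp add: const_fun_def scalar_fun_def fun_eq_iff)
  then show ?thesis by (simp add: superalg.const superalg.prod assms)
qed

lemma superalg_sum: "finite A \<Longrightarrow> (\<And>a. a \<in> A \<Longrightarrow> F a \<in> superalg V) \<Longrightarrow> sum F A \<in> superalg V"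
  by (induction A rule: finite_induct) (auto simp: superalg_zero superalg.add)

lemma parity_superalg: "\<omega> \<in> superalg V \<Longrightarrow> parity \<omega> \<in> superalg V"
proof (induction rule: superalg.induct)
  case (const c)
  have "parity (const_fun V c) = const_fun V c"
    by (auto simp: parity_def const_fun_def restr_def fun_eq_iff)
  then show ?case by (simp add: superalg.const)
next
  case (fst \<phi>)
  have "parity (fst_fun V \<phi>) = fst_fun V \<phi>"
    by (auto simp: parity_def fst_fun_def restr_def fun_eq_iff)
  with fst show ?case by (simp add: superalg.fst)
next
  case (snd \<phi>)
  have "parity (snd_fun V \<phi>) = snd_fun V \<phi>"
    by (auto simp: parity_def snd_fun_def restr_def fun_eq_iff)
  with snd show ?case by (simp add: superalg.snd)
next
  case (odd \<phi>)
  have eq: "parity (odd_fun V \<phi>) = - odd_fun V \<phi>"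
    by (auto simp: parity_def odd_fun_def restr_def fun_eq_iff)
  show ?case unfolding eq using odd by (intro superalg_uminus superalg.odd)
next
  case (add \<alpha> \<beta>)
  show ?case unfolding parity_add using add.IH by (rule superalg.add)
next
  case (prod \<alpha> \<beta>)
  show ?case unfolding parity_prod using prod.IH by (rule superalg.prod)
qed

section \<open>Contraction of forms with a fixed matrix\<close>

definition contract ::
  "('k::field, 'n::finite) matrices \<Rightarrow> ('k, 'n) superfun \<Rightarrow> ('k, 'n) superfun" where
  "contract v \<omega> = (\<lambda>\<xi> \<eta> vs. \<omega> \<xi> \<eta> (v # vs))"

lemma contract_add: "contract v (\<alpha> + \<beta>) = contract v \<alpha> + contract v \<beta>"
  by (simp add: contract_def fun_eq_iff)

lemma contract_parity: "contract v (parity \<alpha>) = - parity (contract v \<alpha>)"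
  by (simp add: contract_def parity_def fun_eq_iff)

text \<open>Exchanging \<open>v\<close> with \<open>[\<xi>, \<eta>]\<close> in the argument list reduces this to \<open>differential_prod\<close>.\<close>

lemma contract_prod: "contract v (\<alpha> \<odot> \<beta>) = contract v \<alpha> \<odot> \<beta> + parity \<alpha> \<odot> contract v \<beta>"
proof (intro ext)
  fix \<xi> \<eta> :: "('a, 'b) matrices" and vs :: "('a, 'b) matrices list"
  define h where "h = Transposition.transpose v (bracket \<xi> \<eta>)"
  define \<alpha>' \<beta>' where "\<alpha>' = (\<lambda>(x :: ('a, 'b) matrices) (y :: ('a, 'b) matrices) us. \<alpha> \<xi> \<eta> (map h us))"
    and "\<beta>' = (\<lambda>(x :: ('a, 'b) matrices) (y :: ('a, 'b) matrices) us. \<beta> \<xi> \<eta> (map h us))"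
  have h: "h v = bracket \<xi> \<eta>" "h (bracket \<xi> \<eta>) = v" "map h (map h us) = us" for us
    by (simp_all add: h_def comp_def)
  have "contract v (\<alpha> \<odot> \<beta>) \<xi> \<eta> vs = (\<alpha> \<odot> \<beta>) \<xi> \<eta> (map h (bracket \<xi> \<eta> # map h vs))"
    unfolding list.map h contract_def ..
  also have "\<dots> = differential (\<alpha>' \<odot> \<beta>') \<xi> \<eta> (map h vs)"
    unfolding super_prod_map[of \<alpha> \<beta> \<xi> \<eta> h _ \<xi> \<eta>] \<alpha>'_def \<beta>'_def differential_def ..
  also have "\<dots> = (differential \<alpha>' \<odot> \<beta>') \<xi> \<eta> (map h vs) + (parity \<alpha>' \<odot> differential \<beta>') \<xi> \<eta> (map h vs)"
    unfolding differential_prod plus_fun_apply ..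
  also have "(differential \<alpha>' \<odot> \<beta>') \<xi> \<eta> (map h vs) = (contract v \<alpha> \<odot> \<beta>) \<xi> \<eta> vs"
    unfolding super_prod_map[of _ _ _ _ _ _ \<xi> \<eta>] \<alpha>'_def \<beta>'_def differential_def contract_def list.map h
    by (rule super_prod_cong) (rule refl)+
  also have "(parity \<alpha>' \<odot> differential \<beta>') \<xi> \<eta> (map h vs) = (parity \<alpha> \<odot> contract v \<beta>) \<xi> \<eta> vs"
    unfolding super_prod_map[of _ _ _ _ _ _ \<xi> \<eta>] \<alpha>'_def \<beta>'_def differential_def contract_def
      parity_def length_map list.map h
    by (rule super_prod_cong) (rule refl)+
  finally show "contract v (\<alpha> \<odot> \<beta>) \<xi> \<eta> vs = (contract v \<alpha> \<odot> \<beta> + parity \<alpha> \<odot> contract v \<beta>) \<xi> \<eta> vs"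
    by simp
qed

lemma contract_base:
  "contract v (const_fun V c) = 0" "contract v (fst_fun V \<phi>) = 0" "contract v (snd_fun V \<phi>) = 0"
  "contract v (odd_fun V \<phi>) = (if v \<in> V then const_fun V (\<phi> v) else 0)"
  by (auto simp: contract_def const_fun_def fst_fun_def snd_fun_def odd_fun_def restr_def fun_eq_iff)

lemma contract_superalg: "\<omega> \<in> superalg V \<Longrightarrow> contract v \<omega> \<in> superalg V"
proof (induction rule: superalg.induct)
  case (add \<alpha> \<beta>)
  show ?case unfolding contract_add using add.IH by (rule superalg.add)
next
  case (prod \<alpha> \<beta>)
  show ?case unfolding contract_prod
    using prod by (intro superalg.add superalg.prod parity_superalg)
qed (simp_all add: contract_base superalg_zero superalg.const del: zero_fun_apply)

text \<open>Alternation of the forms, in a shape that can be proved along the generation of the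
  algebra: for a product the Leibniz rule is applied twice, \<open>contract_parity\<close> gives the
  two mixed terms opposite signs, and the other terms change sign by induction.\<close>

lemma contract_swap:
  "\<omega> \<in> superalg V \<Longrightarrow> contract u (contract v \<omega>) = - contract v (contract u \<omega>)"
proof (induction rule: superalg.induct)
  case (add \<alpha> \<beta>)
  then show ?case by (simp only: contract_add minus_add_distrib)
next
  case (prod \<alpha> \<beta>)
  then show ?case
    by (simp only: contract_add contract_prod contract_parity super_prod_minus_left
        super_prod_minus_right parity_parity minus_add_distrib minus_minus ac_simps)
qed (auto simp: contract_def const_fun_def fst_fun_def snd_fun_def odd_fun_def restr_def fun_eq_iff)

text \<open>Only the first odd argument is treated; later ones are reached by contracting the
  earlier ones away, which stays inside the algebra.\<close>

lemma contract_linear: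
  assumes V: "matspace V" and "\<omega> \<in> superalg V" and u: "u \<in> V" "v \<in> V"
  shows "contract (u + v) \<omega> = contract u \<omega> + contract v \<omega>"
    and "contract (mscale c u) \<omega> = (\<lambda>\<xi> \<eta> vs. c * contract u \<omega> \<xi> \<eta> vs)"
  using assms(2)
proof (induction rule: superalg.induct)
  case (odd \<phi>)
  case 1
  show ?case using odd u V
    by (auto simp: contract_base matspace_add dual_add const_fun_def restr_def fun_eq_iff)
  case 2
  show ?case using odd u V
    by (auto simp: contract_base matspace_scale dual_scale const_fun_def restr_def fun_eq_iff)
next
  case (prod \<alpha> \<beta>)
  have sc: "(\<lambda>\<xi> \<eta> vs. c * \<gamma> \<xi> \<eta> vs) \<odot> \<delta> = (\<lambda>\<xi> \<eta> vs. c * (\<gamma> \<odot> \<delta>) \<xi> \<eta> vs)"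
      "\<gamma> \<odot> (\<lambda>\<xi> \<eta> vs. c * \<delta> \<xi> \<eta> vs) = (\<lambda>\<xi> \<eta> vs. c * (\<gamma> \<odot> \<delta>) \<xi> \<eta> vs)"
    for \<gamma> \<delta> :: "('a, 'b) superfun"
    by (auto simp: super_prod_def fun_eq_iff sum_distrib_left ac_simps)
  case 1
  show ?case
    by (simp only: contract_prod prod.IH super_prod_distrib_left super_prod_distrib_right ac_simps)
  case 2
  show ?case
    by (simp only: contract_prod prod.IH sc) (simp add: fun_eq_iff distrib_left)
next
  case (add \<alpha> \<beta>)
  case 1
  show ?case by (simp only: contract_add add.IH ac_simps)
  case 2
  show ?case by (simp only: contract_add add.IH) (simp add: fun_eq_iff distrib_left)
qed (auto simp: contract_base fun_eq_iff)

lemma contract_zero: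
  assumes "matspace V" "\<omega> \<in> superalg V" shows "contract 0 \<omega> = 0"
  using contract_linear(2)[OF assms matspace_zero[OF assms(1)] matspace_zero[OF assms(1)], of 0]
  by (simp add: fun_eq_iff)

section \<open>Functorialities\<close>

definition mat_linear ::
  "('k::field, 'n::finite) matrices set \<Rightarrow> ('k, 'n) matrices set \<Rightarrow>
   (('k, 'n) matrices \<Rightarrow> ('k, 'n) matrices) \<Rightarrow> bool" where
  "mat_linear V W f \<longleftrightarrow> (\<forall>x\<in>V. f x \<in> W) \<and> (\<forall>x\<in>V. \<forall>y\<in>V. f (x + y) = f x + f y) \<and>
     (\<forall>c. \<forall>x\<in>V. f (mscale c x) = mscale c (f x))"

text \<open>The substitution homomorphism of an affine map: translations move the even arguments
  only, since the odd ones behave like tangent directions. Restriction, projection to the traceless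
  part and evaluation at interpolation nodes are all instances.\<close>

definition pullback ::
  "('k::field, 'n::finite) matrices set \<Rightarrow> (('k, 'n) matrices \<Rightarrow> ('k, 'n) matrices) \<Rightarrow>
   ('k, 'n) matrices \<Rightarrow> ('k, 'n) matrices \<Rightarrow> ('k, 'n) superfun \<Rightarrow> ('k, 'n) superfun" where
  "pullback V f a b \<omega> = restr V (\<lambda>\<xi> \<eta> vs. \<omega> (f \<xi> + a) (f \<eta> + b) (map f vs))"

lemma pullback_add: "pullback V f a b (\<alpha> + \<beta>) = pullback V f a b \<alpha> + pullback V f a b \<beta>"
  by (auto simp: pullback_def restr_def fun_eq_iff)

lemma pullback_zero: "pullback W f a b 0 = 0"
  by (auto simp: pullback_def restr_def fun_eq_iff)

lemma pullback_prod: "pullback V f a b (\<alpha> \<odot> \<beta>) = pullback V f a b \<alpha> \<odot> pullback V f a b \<beta>"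
proof -
  have "(\<lambda>\<xi> \<eta> vs. (\<alpha> \<odot> \<beta>) (f \<xi> + a) (f \<eta> + b) (map f vs)) =
      (\<lambda>\<xi> \<eta> vs. \<alpha> (f \<xi> + a) (f \<eta> + b) (map f vs)) \<odot> (\<lambda>\<xi> \<eta> vs. \<beta> (f \<xi> + a) (f \<eta> + b) (map f vs))"
    by (intro ext) (simp add: super_prod_def nths_map)
  then show ?thesis by (simp add: pullback_def restr_prod)
qed

text \<open>Checked on generators: an even linear function becomes a linear one plus the constant
  \<open>\<phi> a\<close> or \<open>\<phi> b\<close>, an odd one stays linear. Composites with
  \<open>f\<close> are cut off outside \<open>V\<close>, since elements of \<open>dual V\<close>
  vanish there.\<close>

lemma pullback_superalg:
  assumes "\<omega> \<in> superalg W" and V: "matspace V" and f: "mat_linear V W f" and ab: "a \<in> W" "b \<in> W"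
    and W: "matspace W"
  shows "pullback V f a b \<omega> \<in> superalg V"
  using assms(1)
proof (induction rule: superalg.induct)
  case (const c)
  have "pullback V f a b (const_fun W c) = const_fun V c"
    using f ab W by (auto simp: pullback_def const_fun_def restr_def fun_eq_iff mat_linear_def matspace_add)
  then show ?case by (simp add: superalg.const)
next
  case (fst \<phi>)
  let ?\<phi> = "\<lambda>x. if x \<in> V then \<phi> (f x) else 0"
  have "?\<phi> \<in> dual V"
    using f V fst by (auto simp: dual_def mat_linear_def matspace_add matspace_scale)
  moreover have "pullback V f a b (fst_fun W \<phi>) = fst_fun V ?\<phi> + const_fun V (\<phi> a)"
    using f ab W fst
    by (auto simp: pullback_def fst_fun_def const_fun_def restr_def fun_eq_iff mat_linear_def matspace_add dual_add)
  ultimately show ?case by (auto intro: superalg.add superalg.fst superalg.const simp del: plus_fun_apply)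
next
  case (snd \<phi>)
  let ?\<phi> = "\<lambda>x. if x \<in> V then \<phi> (f x) else 0"
  have "?\<phi> \<in> dual V"
    using f V snd by (auto simp: dual_def mat_linear_def matspace_add matspace_scale)
  moreover have "pullback V f a b (snd_fun W \<phi>) = snd_fun V ?\<phi> + const_fun V (\<phi> b)"
    using f ab W snd
    by (auto simp: pullback_def snd_fun_def const_fun_def restr_def fun_eq_iff mat_linear_def matspace_add dual_add)
  ultimately show ?case by (auto intro: superalg.add superalg.snd superalg.const simp del: plus_fun_apply)
next
  case (odd \<phi>)
  let ?\<phi> = "\<lambda>x. if x \<in> V then \<phi> (f x) else 0"
  have "?\<phi> \<in> dual V"
    using f V odd by (auto simp: dual_def mat_linear_def matspace_add matspace_scale)
  moreover have "pullback V f a b (odd_fun W \<phi>) = odd_fun V ?\<phi>"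
    using f ab W odd
    by (auto simp: pullback_def odd_fun_def restr_def fun_eq_iff mat_linear_def matspace_add length_Suc_conv)
  ultimately show ?case by (auto intro: superalg.odd)
next
  case (add \<alpha> \<beta>)
  show ?case unfolding pullback_add using add.IH by (rule superalg.add)
next
  case (prod \<alpha> \<beta>)
  show ?case unfolding pullback_prod using prod.IH by (rule superalg.prod)
qed

lemma restr_eq_pullback: "restr V \<omega> = pullback V id 0 0 \<omega>"
  by (simp add: pullback_def)

lemma restr_in_superalg:
  assumes "\<omega> \<in> superalg W" "matspace V" "matspace W" "V \<subseteq> W"
  shows "restr V \<omega> \<in> superalg V"
  unfolding restr_eq_pullback
  by (rule pullback_superalg[OF assms(1,2)]) (use assms in \<open>auto simp: mat_linear_def matspace_zero\<close>)

section \<open>Scalar functions and interpolation\<close>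

lemma scalar_fun_mult:
  "scalar_fun V g \<odot> scalar_fun V h = scalar_fun V (\<lambda>\<xi> \<eta>. g \<xi> \<eta> * h \<xi> \<eta>)"
proof -
  have "restr V (scalar_fun V h) = scalar_fun V h"
    by (simp add: scalar_fun_def restr_restr)
  from scalar_fun_prod[OF this, of g] show ?thesis
    by (auto simp: scalar_fun_def restr_def fun_eq_iff)
qed

lemma scalar_fun_superalg_prod:
  "finite A \<Longrightarrow> (\<And>i. i \<in> A \<Longrightarrow> scalar_fun V (g i) \<in> superalg V) \<Longrightarrow>
    scalar_fun V (\<lambda>\<xi> \<eta>. \<Prod>i\<in>A. g i \<xi> \<eta>) \<in> superalg V"
proof (induction A rule: finite_induct)
  case empty
  have "scalar_fun V (\<lambda>\<xi> \<eta>. \<Prod>i\<in>{}. g i \<xi> \<eta>) = const_fun V 1"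
    by (simp add: scalar_fun_def const_fun_def)
  then show ?case by (simp add: superalg.const)
next
  case (insert i A)
  have "scalar_fun V (\<lambda>\<xi> \<eta>. \<Prod>i\<in>insert i A. g i \<xi> \<eta>) =
      scalar_fun V (g i) \<odot> scalar_fun V (\<lambda>\<xi> \<eta>. \<Prod>i\<in>A. g i \<xi> \<eta>)"
    using insert.hyps by (simp add: scalar_fun_mult)
  then show ?case using insert by (auto intro: superalg.prod)
qed

text \<open>The Lagrange basis polynomial for the nodes \<open>0, ..., N\<close>; characteristic 0
  keeps the denominators nonzero.\<close>

definition lagrange :: "nat \<Rightarrow> nat \<Rightarrow> 'k::field_char_0 \<Rightarrow> 'k" where
  "lagrange N i s = (\<Prod>j\<in>{..N} - {i}. (s - of_nat j) / (of_nat i - of_nat j))"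

lemma lagrange_interpolation:
  fixes p :: "'k::field_char_0 poly"
  assumes "degree p \<le> N"
  shows "poly p s = (\<Sum>i\<le>N. lagrange N i s * poly p (of_nat i))"
proof -
  define L :: "nat \<Rightarrow> 'k poly" where
    "L i = (\<Prod>j\<in>{..N} - {i}. smult (1 / (of_nat i - of_nat j)) [:- of_nat j, 1:])" for i
  have L: "poly (L i) s = lagrange N i s" for i s
    by (simp add: L_def lagrange_def poly_prod diff_divide_distrib)
  have deg: "degree (L i) \<le> N" if "i \<le> N" for i
  proof -
    have "degree (L i) \<le> (\<Sum>j\<in>{..N} - {i}. 1)"
      unfolding L_def by (rule order.trans[OF degree_prod_sum_le]) (auto intro!: sum_mono order.trans[OF degree_smult_le])
    also have "\<dots> \<le> N" using that by simp
    finally show ?thesis .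
  qed
  \<comment> \<open>The difference has degree at most \<open>N\<close> and vanishes at the
    \<open>N + 1\<close> nodes.\<close>
  define q where "q = p - (\<Sum>i\<le>N. smult (poly p (of_nat i)) (L i))"
  have node: "poly (L i) (of_nat k) = (if i = k then 1 else 0)" if "k \<le> N" for i k
  proof (cases "i = k")
    case True
    then show ?thesis by (simp add: L lagrange_def)
  next
    case False
    then have "k \<in> {..N} - {i}" using that by simp
    then show ?thesis using False by (auto simp: L lagrange_def intro!: prod_zero)
  qed
  have "q = 0"
  proof (rule ccontr)
    assume "q \<noteq> 0"
    have "degree q \<le> N"
      unfolding q_def using assms deg
      by (intro degree_diff_le degree_sum_le) (auto intro: order.trans[OF degree_smult_le])
    have "of_nat ` {..N} \<subseteq> {x. poly q x = 0}"
      by (auto simp: q_def poly_sum node if_distrib[of "(*) _"] cong: if_cong)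
    then have "card (of_nat ` {..N} :: 'k set) \<le> card {x. poly q x = 0}"
      using \<open>q \<noteq> 0\<close> by (intro card_mono poly_roots_finite)
    also have "\<dots> \<le> N"
      using card_poly_roots_bound[OF \<open>q \<noteq> 0\<close>] \<open>degree q \<le> N\<close> by simp
    finally show False by (simp add: card_image inj_on_def)
  qed
  then have "poly p s = poly (\<Sum>i\<le>N. smult (poly p (of_nat i)) (L i)) s"
    by (simp add: q_def)
  then show ?thesis by (simp add: poly_sum L mult.commute)
qed

text \<open>The degree bound precedes the quantifiers over points and odd arguments, so that one set
  of nodes serves all of them. In a product the factors are evaluated on sublists of
  \<open>vs\<close>, which is covered because the bound is uniform in the list.\<close>

lemma superalg_poly_along:
  fixes V :: "('k::field, 'n::finite) matrices set"
  assumes "\<omega> \<in> superalg V" and V: "matspace V" "a \<in> V" "b \<in> V"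
  shows "\<exists>N. \<forall>\<xi>\<in>V. \<forall>\<eta>\<in>V. \<forall>vs. \<exists>p. degree p \<le> N \<and>
    (\<forall>s. \<omega> (\<xi> + mscale s a) (\<eta> + mscale s b) vs = poly p s)"
  using assms(1)
proof (induction rule: superalg.induct)
  case (const c)
  show ?case
  proof (rule exI[of _ 0], intro ballI allI)
    fix \<xi> \<eta> vs assume "\<xi> \<in> V" "\<eta> \<in> V"
    then show "\<exists>p. degree p \<le> 0 \<and> (\<forall>s. const_fun V c (\<xi> + mscale s a) (\<eta> + mscale s b) vs = poly p s)"
      using V by (intro exI[of _ "[:if vs = [] then c else 0:]"])
        (auto simp: const_fun_def restr_def matspace_add matspace_scale)
  qed
next
  case (fst \<phi>)
  show ?case
  proof (rule exI[of _ 1], intro ballI allI)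
    fix \<xi> \<eta> vs assume "\<xi> \<in> V" "\<eta> \<in> V"
    then show "\<exists>p. degree p \<le> 1 \<and> (\<forall>s. fst_fun V \<phi> (\<xi> + mscale s a) (\<eta> + mscale s b) vs = poly p s)"
      using V fst by (intro exI[of _ "if vs = [] then [:\<phi> \<xi>, \<phi> a:] else 0"])
        (auto simp: fst_fun_def restr_def matspace_add matspace_scale dual_add dual_scale)
  qed
next
  case (snd \<phi>)
  show ?case
  proof (rule exI[of _ 1], intro ballI allI)
    fix \<xi> \<eta> vs assume "\<xi> \<in> V" "\<eta> \<in> V"
    then show "\<exists>p. degree p \<le> 1 \<and> (\<forall>s. snd_fun V \<phi> (\<xi> + mscale s a) (\<eta> + mscale s b) vs = poly p s)"
      using V snd by (intro exI[of _ "if vs = [] then [:\<phi> \<eta>, \<phi> b:] else 0"])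
        (auto simp: snd_fun_def restr_def matspace_add matspace_scale dual_add dual_scale)
  qed
next
  case (odd \<phi>)
  show ?case
  proof (rule exI[of _ 0], intro ballI allI)
    fix \<xi> \<eta> vs assume "\<xi> \<in> V" "\<eta> \<in> V"
    then show "\<exists>p. degree p \<le> 0 \<and> (\<forall>s. odd_fun V \<phi> (\<xi> + mscale s a) (\<eta> + mscale s b) vs = poly p s)"
      using V by (intro exI[of _ "[:odd_fun V \<phi> \<xi> \<eta> vs:]"])
        (auto simp: odd_fun_def restr_def matspace_add matspace_scale)
  qed
next
  case (add \<alpha> \<beta>)
  from add.IH obtain M N where
    M: "\<And>\<xi> \<eta> vs. \<xi> \<in> V \<Longrightarrow> \<eta> \<in> V \<Longrightarrow> \<exists>p. degree p \<le> M \<and>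
      (\<forall>s. \<alpha> (\<xi> + mscale s a) (\<eta> + mscale s b) vs = poly p s)" and
    N: "\<And>\<xi> \<eta> vs. \<xi> \<in> V \<Longrightarrow> \<eta> \<in> V \<Longrightarrow> \<exists>p. degree p \<le> N \<and>
      (\<forall>s. \<beta> (\<xi> + mscale s a) (\<eta> + mscale s b) vs = poly p s)"
    by blast
  show ?case
  proof (rule exI[of _ "max M N"], intro ballI allI)
    fix \<xi> \<eta> vs assume "\<xi> \<in> V" "\<eta> \<in> V"
    then obtain p q where "degree p \<le> M" "\<forall>s. \<alpha> (\<xi> + mscale s a) (\<eta> + mscale s b) vs = poly p s"
      "degree q \<le> N" "\<forall>s. \<beta> (\<xi> + mscale s a) (\<eta> + mscale s b) vs = poly q s"
      using M N by metis
    then show "\<exists>p. degree p \<le> max M N \<and>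
        (\<forall>s. (\<alpha> + \<beta>) (\<xi> + mscale s a) (\<eta> + mscale s b) vs = poly p s)"
      by (intro exI[of _ "p + q"]) (auto intro: degree_add_le)
  qed
next
  case (prod \<alpha> \<beta>)
  from prod.IH obtain M N where
    M: "\<And>\<xi> \<eta> vs. \<xi> \<in> V \<Longrightarrow> \<eta> \<in> V \<Longrightarrow> \<exists>p. degree p \<le> M \<and>
      (\<forall>s. \<alpha> (\<xi> + mscale s a) (\<eta> + mscale s b) vs = poly p s)" and
    N: "\<And>\<xi> \<eta> vs. \<xi> \<in> V \<Longrightarrow> \<eta> \<in> V \<Longrightarrow> \<exists>p. degree p \<le> N \<and>
      (\<forall>s. \<beta> (\<xi> + mscale s a) (\<eta> + mscale s b) vs = poly p s)"
    by blast
  show ?case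
  proof (rule exI[of _ "M + N"], intro ballI allI)
    fix \<xi> \<eta> vs assume "\<xi> \<in> V" "\<eta> \<in> V"
    then obtain P Q where P: "\<And>us. degree (P us) \<le> M"
      "\<And>us s. \<alpha> (\<xi> + mscale s a) (\<eta> + mscale s b) us = poly (P us) s"
      and Q: "\<And>us. degree (Q us) \<le> N"
      "\<And>us s. \<beta> (\<xi> + mscale s a) (\<eta> + mscale s b) us = poly (Q us) s"
      using M N by metis
    let ?p = "\<Sum>I\<in>Pow {..<length vs}. smult (shuffle_sign (length vs) I) (P (nths vs I) * Q (nths vs (- I)))"
    have "degree ?p \<le> M + N"
      by (intro degree_sum_le finite_Pow_iff[THEN iffD2] finite_lessThan)
        (meson P(1) Q(1) add_mono degree_mult_le degree_smult_le order.trans)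
    then show "\<exists>p. degree p \<le> M + N \<and>
        (\<forall>s. (\<alpha> \<odot> \<beta>) (\<xi> + mscale s a) (\<eta> + mscale s b) vs = poly p s)"
      by (intro exI[of _ ?p]) (simp add: super_prod_def P Q poly_sum mult.assoc)
  qed
qed

text \<open>One variable at a time, along \<open>(a, 0)\<close> and along \<open>(0, a)\<close>. The
  larger of the two degree bounds is used for both, so that the nodes form a square grid.\<close>

lemma superalg_interpolation:
  fixes V :: "('k::field_char_0, 'n::finite) matrices set"
  assumes \<omega>: "\<omega> \<in> superalg V" and V: "matspace V" "a \<in> V"
  shows "\<exists>N. \<forall>\<xi>\<in>V. \<forall>\<eta>\<in>V. \<forall>vs s t. \<omega> (\<xi> + mscale s a) (\<eta> + mscale t a) vs =
    (\<Sum>i\<le>N. \<Sum>j\<le>N. lagrange N i s * lagrange N j t *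
       \<omega> (\<xi> + mscale (of_nat i) a) (\<eta> + mscale (of_nat j) a) vs)"
proof -
  have 0: "0 \<in> V" using V by (simp add: matspace_zero)
  obtain M1 where M1: "\<And>\<xi> \<eta> vs. \<xi> \<in> V \<Longrightarrow> \<eta> \<in> V \<Longrightarrow> \<exists>p. degree p \<le> M1 \<and>
      (\<forall>s. \<omega> (\<xi> + mscale s a) \<eta> vs = poly p s)"
    using superalg_poly_along[OF \<omega> V 0] by (simp only: mscale_simps add_0_right) blast
  obtain M2 where M2: "\<And>\<xi> \<eta> vs. \<xi> \<in> V \<Longrightarrow> \<eta> \<in> V \<Longrightarrow> \<exists>p. degree p \<le> M2 \<and>
      (\<forall>s. \<omega> \<xi> (\<eta> + mscale s a) vs = poly p s)"
    using superalg_poly_along[OF \<omega> V(1) 0 V(2)] by (simp only: mscale_simps add_0_right) blast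
  define N where "N = max M1 M2"
  have 1: "\<omega> (\<xi> + mscale s a) \<eta> vs = (\<Sum>i\<le>N. lagrange N i s * \<omega> (\<xi> + mscale (of_nat i) a) \<eta> vs)"
    if "\<xi> \<in> V" "\<eta> \<in> V" for \<xi> \<eta> vs s
    using M1[OF that, of vs] lagrange_interpolation[of _ N s] by (auto simp: N_def)
  have 2: "\<omega> \<xi> (\<eta> + mscale t a) vs = (\<Sum>j\<le>N. lagrange N j t * \<omega> \<xi> (\<eta> + mscale (of_nat j) a) vs)"
    if "\<xi> \<in> V" "\<eta> \<in> V" for \<xi> \<eta> vs t
    using M2[OF that, of vs] lagrange_interpolation[of _ N t] by (auto simp: N_def)
  show ?thesis
  proof (rule exI[of _ N], intro ballI allI)
    fix \<xi> \<eta> vs s t assume "\<xi> \<in> V" "\<eta> \<in> V"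
    then have "\<eta> + mscale t a \<in> V" "\<And>i. \<xi> + mscale i a \<in> V"
      using V by (auto intro: matspace_add matspace_scale)
    with \<open>\<xi> \<in> V\<close> \<open>\<eta> \<in> V\<close> show "\<omega> (\<xi> + mscale s a) (\<eta> + mscale t a) vs =
      (\<Sum>i\<le>N. \<Sum>j\<le>N. lagrange N i s * lagrange N j t *
       \<omega> (\<xi> + mscale (of_nat i) a) (\<eta> + mscale (of_nat j) a) vs)"
      by (subst 1) (simp_all add: 2 sum_distrib_left mult.assoc)
  qed
qed

section \<open>Splitting off the scalar matrices\<close>

text \<open>The coordinate along the identity matrix, normalised to be 1 there; characteristic 0
  permits the division.\<close>

definition mean_trace :: "('k::field_char_0, 'n::finite) matrices \<Rightarrow> 'k" where
  "mean_trace x = trace x / of_nat CARD('n)"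

definition traceless :: "('k::field_char_0, 'n::finite) matrices \<Rightarrow> ('k, 'n) matrices" where
  "traceless x = x - mscale (mean_trace x) (mat 1)"

lemma trace_mscale: "trace (mscale c x) = c * trace x"
  by (simp add: trace_def sum_distrib_left)

lemma mean_trace_add: "mean_trace (x + y) = mean_trace x + mean_trace y"
  and mean_trace_mscale: "mean_trace (mscale c x) = c * mean_trace x"
  by (simp_all add: mean_trace_def trace_add trace_mscale add_divide_distrib)

lemma traceless_add: "traceless (x + y) = traceless x + traceless y"
  and traceless_mscale: "traceless (mscale c x) = mscale c (traceless x)"
  by (simp_all add: traceless_def mean_trace_add mean_trace_mscale vec_eq_iff algebra_simps)

lemma mean_trace_mat_1: "mean_trace (mat 1 :: ('k::field_char_0, 'n::finite) matrices) = 1"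
  by (simp add: mean_trace_def trace_I)

lemma traceless_in_sl: "traceless x \<in> sl"
  using mean_trace_mat_1[where ?'k = 'a and ?'n = 'b]
  by (simp add: traceless_def sl_def trace_sub trace_mscale mean_trace_def field_simps)

lemma mean_trace_sl: "x \<in> sl \<Longrightarrow> mean_trace x = 0"
  by (simp add: mean_trace_def sl_def)

lemma traceless_sl: "x \<in> sl \<Longrightarrow> traceless x = x"
  by (simp add: traceless_def mean_trace_sl)

lemma traceless_split: "traceless x + mscale (mean_trace x) (mat 1) = x"
  by (simp add: traceless_def)

lemma matspace_sl: "matspace sl"
  by (auto simp: matspace_def sl_def trace_add trace_mscale) (simp add: trace_def)

lemma matspace_Int: "matspace V \<Longrightarrow> matspace W \<Longrightarrow> matspace (V \<inter> W)"
  by (simp add: matspace_def)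

abbreviation lift :: "('k::field_char_0, 'n::finite) matrices set \<Rightarrow> ('k, 'n) superfun \<Rightarrow> ('k, 'n) superfun" where
  "lift V \<equiv> pullback V traceless 0 0"

text \<open>Restriction to the pairs of matrices with mean traces \<open>i\<close> and
  \<open>j\<close>, translated back to traceless matrices.\<close>

definition slice :: "('k::field_char_0, 'n::finite) matrices set \<Rightarrow> nat \<Rightarrow> nat \<Rightarrow> ('k, 'n) superfun \<Rightarrow> ('k, 'n) superfun" where
  "slice V i j = pullback (V \<inter> sl) id (mscale (of_nat i) (mat 1)) (mscale (of_nat j) (mat 1))"

abbreviation node_fun :: "('k::field_char_0, 'n::finite) matrices set \<Rightarrow> nat \<Rightarrow> nat \<Rightarrow> nat \<Rightarrow> ('k, 'n) superfun" where
  "node_fun V N i j \<equiv> scalar_fun V (\<lambda>\<xi> \<eta>. lagrange N i (mean_trace \<xi>) * lagrange N j (mean_trace \<eta>))"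

text \<open>The odd scalar coordinate \<open>odd_fun V mean_trace\<close> squares to zero, so every
  form is a part free of it plus that coordinate times another such part. \<open>\<zeta> i j\<close>
  and \<open>\<zeta>' i j\<close> prescribe the two parts at the node \<open>(i, j)\<close>.\<close>

definition synth ::
  "('k::field_char_0, 'n::finite) matrices set \<Rightarrow> nat \<Rightarrow> (nat \<Rightarrow> nat \<Rightarrow> ('k, 'n) superfun) \<Rightarrow>
   (nat \<Rightarrow> nat \<Rightarrow> ('k, 'n) superfun) \<Rightarrow> ('k, 'n) superfun" where
  "synth V N \<zeta> \<zeta>' = (\<Sum>(i, j)\<in>{..N} \<times> {..N}. node_fun V N i j \<odot>
     (lift V (\<zeta> i j) + odd_fun V mean_trace \<odot> lift V (\<zeta>' i j)))"

text \<open>Instantiated with all matrices and with the diagonal ones, so that \<open>gl\<close> and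
  its Cartan subalgebra are split by the same construction; \<open>V \<inter> sl\<close> is then
  \<open>sl\<close>, respectively its Cartan subalgebra.\<close>

locale central_matspace =
  fixes V :: "('k::field_char_0, 'n::finite) matrices set"
  assumes V: "matspace V" and mat_1_in: "mat 1 \<in> V"
begin

lemma traceless_in: "x \<in> V \<Longrightarrow> traceless x \<in> V \<inter> sl"
  using V mat_1_in by (simp add: traceless_in_sl) (simp add: traceless_def matspace_diff matspace_scale)

lemma V0: "matspace (V \<inter> sl)"
  by (simp add: V matspace_Int matspace_sl)

lemma mean_trace_dual: "(\<lambda>x. if x \<in> V then mean_trace x else 0) \<in> dual V"
  using V by (simp add: dual_def matspace_add matspace_scale mean_trace_add mean_trace_mscale)

lemma odd_fun_mean_trace_superalg: "odd_fun V mean_trace \<in> superalg V"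
proof -
  have "odd_fun V mean_trace = odd_fun V (\<lambda>x. if x \<in> V then mean_trace x else 0)"
    by (auto simp: odd_fun_def restr_def fun_eq_iff length_Suc_conv)
  then show ?thesis by (simp add: superalg.odd mean_trace_dual)
qed

lemma lift_superalg: "\<zeta> \<in> superalg (V \<inter> sl) \<Longrightarrow> lift V \<zeta> \<in> superalg V"
  by (rule pullback_superalg[OF _ V _ _ _ V0])
    (use traceless_in matspace_zero[OF V0] in \<open>auto simp: mat_linear_def traceless_add traceless_mscale\<close>)

lemma slice_superalg: "\<omega> \<in> superalg V \<Longrightarrow> slice V i j \<omega> \<in> superalg (V \<inter> sl)"
  unfolding slice_def
  by (rule pullback_superalg[OF _ V0 _ _ _ V])
    (use V mat_1_in in \<open>auto simp: mat_linear_def matspace_scale\<close>)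

text \<open>Each Lagrange factor is an affine function of one mean trace, hence a constant times a
  generator plus a constant.\<close>

lemma node_fun_superalg: "node_fun V N i j \<in> superalg V"
proof -
  have affine: "scalar_fun V (\<lambda>\<xi> \<eta>. (mean_trace \<xi> - a) / b) \<in> superalg V"
      "scalar_fun V (\<lambda>\<xi> \<eta>. (mean_trace \<eta> - a) / b) \<in> superalg V" for a b
  proof -
    have "scalar_fun V (\<lambda>\<xi> \<eta>. (mean_trace \<xi> - a) / b) =
        const_fun V (1 / b) \<odot> fst_fun V (\<lambda>x. if x \<in> V then mean_trace x else 0) + const_fun V (- a / b)"
      "scalar_fun V (\<lambda>\<xi> \<eta>. (mean_trace \<eta> - a) / b) =
        const_fun V (1 / b) \<odot> snd_fun V (\<lambda>x. if x \<in> V then mean_trace x else 0) + const_fun V (- a / b)"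
      using scalar_fun_mult[of V "\<lambda>_ _. 1 / b" "\<lambda>\<xi> _. if \<xi> \<in> V then mean_trace \<xi> else 0"]
        scalar_fun_mult[of V "\<lambda>_ _. 1 / b" "\<lambda>_ \<eta>. if \<eta> \<in> V then mean_trace \<eta> else 0"]
      by (auto simp: scalar_fun_def const_fun_def fst_fun_def snd_fun_def restr_def fun_eq_iff diff_divide_distrib)
    then show "scalar_fun V (\<lambda>\<xi> \<eta>. (mean_trace \<xi> - a) / b) \<in> superalg V"
      "scalar_fun V (\<lambda>\<xi> \<eta>. (mean_trace \<eta> - a) / b) \<in> superalg V"
      by (auto intro: superalg.intros mean_trace_dual simp del: plus_fun_apply)
  qed
  have "node_fun V N i j = scalar_fun V (\<lambda>\<xi> \<eta>. lagrange N i (mean_trace \<xi>)) \<odot>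
      scalar_fun V (\<lambda>\<xi> \<eta>. lagrange N j (mean_trace \<eta>))"
    by (simp add: scalar_fun_mult)
  then show ?thesis
    unfolding lagrange_def by (auto intro!: superalg.prod scalar_fun_superalg_prod affine)
qed

lemma synth_superalg:
  assumes "\<And>i j. \<zeta> i j \<in> superalg (V \<inter> sl)" "\<And>i j. \<zeta>' i j \<in> superalg (V \<inter> sl)"
  shows "synth V N \<zeta> \<zeta>' \<in> superalg V"
  unfolding synth_def using assms
  by (intro superalg_sum)
    (auto intro!: superalg.prod superalg.add node_fun_superalg lift_superalg odd_fun_mean_trace_superalg
      simp del: plus_fun_apply)

text \<open>
  The scalar component of each odd argument is moved to the front; two scalar arguments cannot
  occur since the forms alternate.
\<close>

lemma odd_decomposition:
  assumes "\<omega> \<in> superalg V" "\<xi> \<in> V" "\<eta> \<in> V" "set vs \<subseteq> V"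
  shows "\<omega> \<xi> \<eta> vs = \<omega> \<xi> \<eta> (map traceless vs) +
    (odd_fun V mean_trace \<odot> (\<lambda>_ _ us. \<omega> \<xi> \<eta> (mat 1 # map traceless us))) \<xi> \<eta> vs"
  using assms
proof (induction vs arbitrary: \<omega>)
  case Nil
  then show ?case by (simp add: super_prod_def odd_fun_def restr_def)
next
  case (Cons v vs)
  let ?\<theta> = "odd_fun V mean_trace"
  have v: "v \<in> V" "set vs \<subseteq> V" "traceless v \<in> V" using Cons.prems traceless_in by auto
  note J = mat_1_in
  have swap: "\<omega> \<xi> \<eta> (x # y # us) = - \<omega> \<xi> \<eta> (y # x # us)" for x y us
    using contract_swap[OF Cons.prems(1), of y x] by (simp add: contract_def fun_eq_iff)
  \<comment> \<open>Characteristic different from 2 enters here: a value equal to its own negative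
    vanishes.\<close>
  then have JJ: "\<omega> \<xi> \<eta> (mat 1 # mat 1 # us) = 0" for us
    using swap[of "mat 1" "mat 1" us] by (simp only: eq_neg_iff_add_eq_0 flip: mult_2) simp
  have "(?\<theta> \<odot> (\<lambda>_ _ us. 0)) \<xi> \<eta> vs = 0" by (simp add: super_prod_def)
  \<comment> \<open>The correction term of the induction hypothesis contains the identity matrix
    twice and drops out.\<close>
  then have pull_J: "\<omega> \<xi> \<eta> (mat 1 # vs) = \<omega> \<xi> \<eta> (mat 1 # map traceless vs)"
    using Cons.IH[OF contract_superalg[OF Cons.prems(1), of "mat 1"] Cons.prems(2,3) v(2)]
    by (simp add: contract_def JJ)
  have pull_v: "\<omega> \<xi> \<eta> (traceless v # vs) = \<omega> \<xi> \<eta> (traceless v # map traceless vs) +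
      (?\<theta> \<odot> (\<lambda>_ _ us. \<omega> \<xi> \<eta> (traceless v # mat 1 # map traceless us))) \<xi> \<eta> vs"
    using Cons.IH[OF contract_superalg[OF Cons.prems(1), of "traceless v"] Cons.prems(2,3) v(2)]
    by (simp add: contract_def)
  let ?\<gamma> = "\<lambda>(_ :: ('k, 'n) matrices) (_ :: ('k, 'n) matrices) us. \<omega> \<xi> \<eta> (mat 1 # map traceless us)"
  have "(?\<theta> \<odot> ?\<gamma>) \<xi> \<eta> (v # vs) = contract v (?\<theta> \<odot> ?\<gamma>) \<xi> \<eta> vs"
    by (simp add: contract_def)
  also have "\<dots> = (const_fun V (mean_trace v) \<odot> ?\<gamma>) \<xi> \<eta> vs + (parity ?\<theta> \<odot> contract v ?\<gamma>) \<xi> \<eta> vs"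
    by (simp add: contract_prod contract_base v)
  \<comment> \<open>The sign from moving the contraction past the odd coordinate cancels against the
    sign from exchanging \<open>mat 1\<close> with \<open>traceless v\<close>.\<close>
  also have "parity ?\<theta> = - ?\<theta>"
    by (auto simp: parity_def odd_fun_def restr_def fun_eq_iff)
  also have "(- ?\<theta> \<odot> contract v ?\<gamma>) \<xi> \<eta> vs = (?\<theta> \<odot> - contract v ?\<gamma>) \<xi> \<eta> vs"
    by (simp only: super_prod_minus_left super_prod_minus_right)
  also have "- contract v ?\<gamma> = (\<lambda>_ _ us. \<omega> \<xi> \<eta> (traceless v # mat 1 # map traceless us))"
    using swap[of "mat 1" "traceless v"] by (simp add: contract_def fun_eq_iff)
  also have "(const_fun V (mean_trace v) \<odot> ?\<gamma>) \<xi> \<eta> vs = (scalar_fun V (\<lambda>_ _. mean_trace v) \<odot> restr V ?\<gamma>) \<xi> \<eta> vs"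
    unfolding const_fun_def scalar_fun_def using Cons.prems v
    by (intro super_prod_cong) (auto simp: restr_def)
  also have "\<dots> = mean_trace v * ?\<gamma> \<xi> \<eta> vs"
    using Cons.prems v by (subst scalar_fun_prod) (simp_all add: restr_restr, simp add: restr_def)
  finally have \<theta>: "(?\<theta> \<odot> ?\<gamma>) \<xi> \<eta> (v # vs) = mean_trace v * \<omega> \<xi> \<eta> (mat 1 # map traceless vs) +
      (?\<theta> \<odot> (\<lambda>_ _ us. \<omega> \<xi> \<eta> (traceless v # mat 1 # map traceless us))) \<xi> \<eta> vs" .
  have "contract v \<omega> = contract (traceless v + mscale (mean_trace v) (mat 1)) \<omega>"
    by (simp add: traceless_split)
  also have "\<dots> = contract (traceless v) \<omega> + (\<lambda>\<xi> \<eta> vs. mean_trace v * contract (mat 1) \<omega> \<xi> \<eta> vs)"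
    using v J V Cons.prems
    by (simp only: contract_linear(1)[OF V Cons.prems(1) v(3) matspace_scale[OF V J]]
        contract_linear(2)[OF V Cons.prems(1) J J])
  finally have "\<omega> \<xi> \<eta> (v # vs) = \<omega> \<xi> \<eta> (traceless v # vs) + mean_trace v * \<omega> \<xi> \<eta> (mat 1 # vs)"
    by (simp add: contract_def fun_eq_iff)
  then show ?case by (simp add: pull_J pull_v \<theta>)
qed

lemma synth_apply:
  assumes "\<xi> \<in> V" "\<eta> \<in> V" "set vs \<subseteq> V"
  shows "synth V N \<zeta> \<zeta>' \<xi> \<eta> vs = (\<Sum>i\<le>N. \<Sum>j\<le>N.
    lagrange N i (mean_trace \<xi>) * lagrange N j (mean_trace \<eta>) *
      (lift V (\<zeta> i j) + odd_fun V mean_trace \<odot> lift V (\<zeta>' i j)) \<xi> \<eta> vs)"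
proof -
  have sum_apply: "(\<Sum>a\<in>A. F a) \<xi> \<eta> vs = (\<Sum>a\<in>A. F a \<xi> \<eta> vs)"
    for A :: "(nat \<times> nat) set" and F :: "nat \<times> nat \<Rightarrow> ('k, 'n) superfun"
    by (induction A rule: infinite_finite_induct) simp_all
  have r: "restr V (lift V (\<zeta> i j) + odd_fun V mean_trace \<odot> lift V (\<zeta>' i j)) =
      lift V (\<zeta> i j) + odd_fun V mean_trace \<odot> lift V (\<zeta>' i j)" for i j
    by (simp add: restr_add restr_prod pullback_def odd_fun_def restr_restr del: plus_fun_apply)
  show ?thesis
    unfolding synth_def sum_apply sum.cartesian_product
    by (intro sum.cong refl) (auto simp only: scalar_fun_prod[OF r] split: prod.split)
qed

text \<open>Each even argument is its traceless part plus a multiple of the identity. Interpolation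
  in the two multiples leaves values at the nodes, where \<open>odd_decomposition\<close> separates
  the odd scalar direction.\<close>

lemma superalg_decomposition:
  assumes \<omega>: "\<omega> \<in> superalg V"
  shows "\<exists>N. synth V N (\<lambda>i j. slice V i j \<omega>) (\<lambda>i j. slice V i j (contract (mat 1) \<omega>)) = \<omega>"
proof -
  let ?\<theta> = "odd_fun V mean_trace"
  obtain N where N: "\<And>\<xi> \<eta> vs s t. \<xi> \<in> V \<Longrightarrow> \<eta> \<in> V \<Longrightarrow>
    \<omega> (\<xi> + mscale s (mat 1)) (\<eta> + mscale t (mat 1)) vs =
    (\<Sum>i\<le>N. \<Sum>j\<le>N. lagrange N i s * lagrange N j t *
       \<omega> (\<xi> + mscale (of_nat i) (mat 1)) (\<eta> + mscale (of_nat j) (mat 1)) vs)"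
    using superalg_interpolation[OF \<omega> V mat_1_in] by blast
  let ?S = "synth V N (\<lambda>i j. slice V i j \<omega>) (\<lambda>i j. slice V i j (contract (mat 1) \<omega>))"
  have "?S \<xi> \<eta> vs = \<omega> \<xi> \<eta> vs" for \<xi> \<eta> vs
  proof (cases "\<xi> \<in> V \<and> \<eta> \<in> V \<and> set vs \<subseteq> V")
    case False
    have "?S \<in> superalg V"
      by (intro synth_superalg slice_superalg contract_superalg \<omega>)
    then show ?thesis
      using superalg_outside[of ?S V \<xi> \<eta> vs] superalg_outside[OF \<omega> False] False by simp
  next
    case True
    then have in_V: "\<xi> \<in> V" "\<eta> \<in> V" "set vs \<subseteq> V" by auto
    have tl: "traceless x \<in> V" "traceless x \<in> sl" if "x \<in> V" for x
      using traceless_in that by auto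
    have node: "traceless x + mscale c (mat 1) \<in> V" if "x \<in> V" for x c
      using that V mat_1_in tl by (simp add: matspace_add matspace_scale)
    have "\<omega> \<xi> \<eta> vs = \<omega> (traceless \<xi> + mscale (mean_trace \<xi>) (mat 1))
        (traceless \<eta> + mscale (mean_trace \<eta>) (mat 1)) vs"
      by (simp add: traceless_split)
    also have "\<dots> = (\<Sum>i\<le>N. \<Sum>j\<le>N. lagrange N i (mean_trace \<xi>) * lagrange N j (mean_trace \<eta>) *
       \<omega> (traceless \<xi> + mscale (of_nat i) (mat 1)) (traceless \<eta> + mscale (of_nat j) (mat 1)) vs)"
      using in_V tl by (intro N) auto
    also have "\<dots> = ?S \<xi> \<eta> vs"
    proof (subst synth_apply[OF in_V], intro sum.cong refl arg_cong2[of _ _ _ _ "(*)"])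
      fix i j
      let ?x = "traceless \<xi> + mscale (of_nat i) (mat 1)" and ?y = "traceless \<eta> + mscale (of_nat j) (mat 1)"
      have xy: "?x \<in> V" "?y \<in> V" using node in_V by auto
      \<comment> \<open>\<open>odd_decomposition\<close> is applied at the node, while the synthesis
        multiplies at \<open>(\<xi>, \<eta>)\<close>; the odd coordinate takes the same values at
        both points.\<close>
      have "(?\<theta> \<odot> (\<lambda>_ _ us. \<omega> ?x ?y (mat 1 # map traceless us))) ?x ?y vs =
          (?\<theta> \<odot> lift V (slice V i j (contract (mat 1) \<omega>))) \<xi> \<eta> vs"
      proof (rule super_prod_cong)
        fix us assume "set us \<subseteq> set vs"
        then have us: "set us \<subseteq> V" using in_V by auto
        show "?\<theta> ?x ?y us = ?\<theta> \<xi> \<eta> us"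
          using xy in_V by (simp add: odd_fun_def restr_def)
        show "\<omega> ?x ?y (mat 1 # map traceless us) = lift V (slice V i j (contract (mat 1) \<omega>)) \<xi> \<eta> us"
          using in_V us tl by (auto simp: pullback_def slice_def restr_def contract_def subset_iff)
      qed
      moreover have "\<omega> ?x ?y (map traceless vs) = lift V (slice V i j \<omega>) \<xi> \<eta> vs"
        using in_V tl by (auto simp: pullback_def slice_def restr_def subset_iff)
      ultimately show "\<omega> ?x ?y vs =
          (lift V (slice V i j \<omega>) + ?\<theta> \<odot> lift V (slice V i j (contract (mat 1) \<omega>))) \<xi> \<eta> vs"
        using odd_decomposition[OF \<omega> xy in_V(3)] by simp
    qed
    finally show ?thesis by simp
  qed
  then show ?thesis by (intro exI[of _ N]) (simp add: fun_eq_iff)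
qed

end

section \<open>Invariants, degrees and differentials of the splitting\<close>

definition invariant_under ::
  "(('k::field, 'n::finite) matrices \<Rightarrow> ('k, 'n) matrices) set \<Rightarrow> ('k, 'n) superfun \<Rightarrow> bool" where
  "invariant_under T \<omega> \<longleftrightarrow> (\<forall>\<tau>\<in>T. \<forall>\<xi> \<eta> vs. \<omega> (\<tau> \<xi>) (\<tau> \<eta>) (map \<tau> vs) = \<omega> \<xi> \<eta> vs)"

lemma invariants_iff:
  "\<omega> \<in> invariants V T p \<longleftrightarrow> \<omega> \<in> superalg V \<and> hom_degree p \<omega> \<and> invariant_under T \<omega>"
  by (simp add: invariants_def invariant_under_def)

lemma hom_degree_add: "hom_degree p \<alpha> \<Longrightarrow> hom_degree p \<beta> \<Longrightarrow> hom_degree p (\<alpha> + \<beta>)"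
  and hom_degree_zero: "hom_degree p 0"
  and hom_degree_uminus: "hom_degree p \<alpha> \<Longrightarrow> hom_degree p (- \<alpha>)"
  and hom_degree_restr: "hom_degree p \<alpha> \<Longrightarrow> hom_degree p (restr V \<alpha>)"
  by (auto simp: hom_degree_def restr_def)

lemma hom_degree_prod:
  assumes "hom_degree p \<alpha>" "hom_degree q \<beta>" shows "hom_degree (p + q) (\<alpha> \<odot> \<beta>)"
  unfolding hom_degree_def
proof (intro allI impI)
  fix \<xi> \<eta> :: "('a, 'b) matrices" and vs :: "('a, 'b) matrices list"
  assume len: "length vs \<noteq> p + q"
  have 0: "\<alpha> \<xi> \<eta> (nths vs I) * \<beta> \<xi> \<eta> (nths vs (- I)) = 0" for I
  proof (cases "length (nths vs I) = p")
    case True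
    then have "length (nths vs (- I)) \<noteq> q" using len length_nths_add[of vs I] by auto
    then show ?thesis using assms by (simp add: hom_degree_def)
  qed (use assms in \<open>simp add: hom_degree_def\<close>)
  show "(\<alpha> \<odot> \<beta>) \<xi> \<eta> vs = 0" by (simp only: super_prod_def mult.assoc 0) simp
qed

lemma hom_degree_pullback: "hom_degree p \<omega> \<Longrightarrow> hom_degree p (pullback V f a b \<omega>)"
  by (simp add: hom_degree_def pullback_def restr_def)

lemma hom_degree_contract: "hom_degree (Suc p) \<omega> \<Longrightarrow> hom_degree p (contract v \<omega>)"
  by (simp add: hom_degree_def contract_def)

lemma contract_degree_0: "hom_degree 0 \<omega> \<Longrightarrow> contract v \<omega> = 0"
  by (simp add: hom_degree_def contract_def fun_eq_iff)

lemma invariant_add: "invariant_under T \<alpha> \<Longrightarrow> invariant_under T \<beta> \<Longrightarrow> invariant_under T (\<alpha> + \<beta>)"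
  and invariant_zero: "invariant_under T 0"
  and invariant_uminus: "invariant_under T \<alpha> \<Longrightarrow> invariant_under T (- \<alpha>)"
  by (simp_all add: invariant_under_def)

lemma invariant_prod:
  "invariant_under T \<alpha> \<Longrightarrow> invariant_under T \<beta> \<Longrightarrow> invariant_under T (\<alpha> \<odot> \<beta>)"
  by (simp add: invariant_under_def super_prod_def nths_map)

lemma invariants_add: "\<alpha> \<in> invariants V T p \<Longrightarrow> \<beta> \<in> invariants V T p \<Longrightarrow> \<alpha> + \<beta> \<in> invariants V T p"
  by (simp add: invariants_iff hom_degree_add invariant_add superalg.add)

lemma invariants_zero: "0 \<in> invariants V T p"
  by (simp add: invariants_iff hom_degree_zero invariant_zero superalg_zero)

lemma invariants_uminus: "\<alpha> \<in> invariants V T p \<Longrightarrow> - \<alpha> \<in> invariants V T p"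
  by (simp add: invariants_iff hom_degree_uminus invariant_uminus superalg_uminus)

lemma invariants_prod:
  "\<alpha> \<in> invariants V T p \<Longrightarrow> \<beta> \<in> invariants V T q \<Longrightarrow> \<alpha> \<odot> \<beta> \<in> invariants V T (p + q)"
  by (simp add: invariants_iff hom_degree_prod invariant_prod superalg.prod)

lemma invariants_sum: "(\<And>a. a \<in> A \<Longrightarrow> F a \<in> invariants V T p) \<Longrightarrow> sum F A \<in> invariants V T p"
  by (induction A rule: infinite_finite_induct) (simp_all add: invariants_zero invariants_add del: plus_fun_apply zero_fun_apply)

text \<open>The chains of the odd scalar direction lie one degree below, so there are none in degree 0.\<close>

definition shifted :: "(nat \<Rightarrow> 'a::zero set) \<Rightarrow> nat \<Rightarrow> 'a set" where
  "shifted C p = (case p of 0 \<Rightarrow> {0} | Suc q \<Rightarrow> C q)"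

text \<open>The common properties of conjugation on all matrices and of the Weyl group on diagonal
  ones; preserving the identity and the trace makes the action compatible with the splitting.
  Membership in \<open>V\<close> is an equivalence because forms vanish outside \<open>V\<close>
  while invariance is demanded for all arguments.\<close>

locale central_action = central_matspace V for V :: "('k::field_char_0, 'n::finite) matrices set" +
  fixes T :: "(('k, 'n) matrices \<Rightarrow> ('k, 'n) matrices) set"
  assumes action_add: "\<tau> \<in> T \<Longrightarrow> \<tau> (x + y) = \<tau> x + \<tau> y"
    and action_scale: "\<tau> \<in> T \<Longrightarrow> \<tau> (mscale c x) = mscale c (\<tau> x)"
    and action_mat_1: "\<tau> \<in> T \<Longrightarrow> \<tau> (mat 1) = mat 1"
    and action_trace: "\<tau> \<in> T \<Longrightarrow> trace (\<tau> x) = trace x"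
    and action_mem: "\<tau> \<in> T \<Longrightarrow> \<tau> x \<in> V \<longleftrightarrow> x \<in> V"
begin

lemma action_sl: "\<tau> \<in> T \<Longrightarrow> \<tau> x \<in> sl \<longleftrightarrow> x \<in> sl"
  by (simp add: sl_def action_trace)

lemma action_subset: "\<tau> \<in> T \<Longrightarrow> \<tau> ` A \<subseteq> V \<longleftrightarrow> A \<subseteq> V" "\<tau> \<in> T \<Longrightarrow> \<tau> ` A \<subseteq> sl \<longleftrightarrow> A \<subseteq> sl"
  by (auto simp: action_mem action_sl)

lemma action_mean_trace: "\<tau> \<in> T \<Longrightarrow> mean_trace (\<tau> x) = mean_trace x"
  by (simp add: mean_trace_def action_trace)

lemma action_traceless: "\<tau> \<in> T \<Longrightarrow> traceless (\<tau> x) = \<tau> (traceless x)"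
  using action_add[of \<tau> x "mscale (- mean_trace x) (mat 1)"]
    action_scale[of \<tau> "- mean_trace x" "mat 1"]
  by (simp add: traceless_def action_mean_trace action_mat_1 mscale_minus_left)

lemma invariant_lift:
  assumes "invariant_under T \<zeta>" shows "invariant_under T (lift V \<zeta>)"
proof -
  have "\<zeta> (traceless (\<tau> \<xi>)) (traceless (\<tau> \<eta>)) (map (traceless \<circ> \<tau>) vs) =
      \<zeta> (traceless \<xi>) (traceless \<eta>) (map traceless vs)" if \<tau>: "\<tau> \<in> T" for \<tau> \<xi> \<eta> vs
  proof -
    have "map (traceless \<circ> \<tau>) vs = map \<tau> (map traceless vs)"
      by (simp add: action_traceless[OF \<tau>])
    then show ?thesis
      using assms \<tau> unfolding invariant_under_def by (simp only: action_traceless)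
  qed
  then show ?thesis
    by (simp add: invariant_under_def pullback_def restr_def action_mem action_subset)
qed

lemma invariant_slice:
  assumes "invariant_under T \<omega>" shows "invariant_under T (slice V i j \<omega>)"
proof -
  have "\<omega> (\<tau> \<xi> + mscale a (mat 1)) (\<tau> \<eta> + mscale b (mat 1)) (map \<tau> vs) =
      \<omega> (\<xi> + mscale a (mat 1)) (\<eta> + mscale b (mat 1)) vs" if \<tau>: "\<tau> \<in> T" for \<tau> \<xi> \<eta> vs a b
  proof -
    have "\<tau> x + mscale c (mat 1) = \<tau> (x + mscale c (mat 1))" for x c
      by (simp add: action_add[OF \<tau>] action_scale[OF \<tau>] action_mat_1[OF \<tau>])
    then show ?thesis
      using assms \<tau> unfolding invariant_under_def by (simp only:)
  qed
  then show ?thesis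
    by (simp add: invariant_under_def slice_def pullback_def restr_def action_mem action_sl action_subset)
qed

lemma invariant_contract:
  assumes "invariant_under T \<omega>" shows "invariant_under T (contract (mat 1) \<omega>)"
  unfolding invariant_under_def contract_def
proof (intro ballI allI)
  fix \<tau> \<xi> \<eta> vs assume \<tau>: "\<tau> \<in> T"
  then have "\<omega> (\<tau> \<xi>) (\<tau> \<eta>) (map \<tau> (mat 1 # vs)) = \<omega> \<xi> \<eta> (mat 1 # vs)"
    using assms unfolding invariant_under_def by blast
  then show "\<omega> (\<tau> \<xi>) (\<tau> \<eta>) (mat 1 # map \<tau> vs) = \<omega> \<xi> \<eta> (mat 1 # vs)"
    by (simp add: action_mat_1[OF \<tau>])
qed

lemma node_fun_invariants: "node_fun V N i j \<in> invariants V T 0"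
  by (auto simp: invariants_iff node_fun_superalg)
    (auto simp: hom_degree_def scalar_fun_def restr_def invariant_under_def action_mem action_mean_trace)

lemma odd_fun_mean_trace_invariants: "odd_fun V mean_trace \<in> invariants V T 1"
  by (auto simp: invariants_iff odd_fun_mean_trace_superalg)
    (auto simp: hom_degree_def odd_fun_def restr_def invariant_under_def action_mem action_mean_trace
      length_Suc_conv)

lemma lift_invariants: "\<zeta> \<in> invariants (V \<inter> sl) T p \<Longrightarrow> lift V \<zeta> \<in> invariants V T p"
  by (simp add: invariants_iff lift_superalg hom_degree_pullback invariant_lift)

lemma slice_invariants: "\<omega> \<in> invariants V T p \<Longrightarrow> slice V i j \<omega> \<in> invariants (V \<inter> sl) T p"
  by (simp add: invariants_iff slice_superalg invariant_slice) (simp add: slice_def hom_degree_pullback)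

lemma contract_slice_invariants:
  assumes "\<omega> \<in> invariants V T p"
  shows "slice V i j (contract (mat 1) \<omega>) \<in> shifted (invariants (V \<inter> sl) T) p"
proof (cases p)
  case 0
  then have "contract (mat 1) \<omega> = 0" using assms by (simp add: invariants_iff contract_degree_0)
  then show ?thesis by (simp add: 0 shifted_def slice_def pullback_zero)
next
  case (Suc q)
  then have "contract (mat 1) \<omega> \<in> invariants V T q"
    using assms by (simp add: invariants_iff contract_superalg hom_degree_contract invariant_contract)
  then show ?thesis by (simp add: Suc shifted_def slice_invariants)
qed

text \<open>Node functions have degree 0, and the odd coordinate raises the degree by one, which
  undoes the shift of \<open>\<zeta>'\<close>.\<close>

lemma synth_invariants:
  assumes "\<And>i j. \<zeta> i j \<in> invariants (V \<inter> sl) T p"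
    and \<zeta>': "\<And>i j. \<zeta>' i j \<in> shifted (invariants (V \<inter> sl) T) p"
  shows "synth V N \<zeta> \<zeta>' \<in> invariants V T p"
proof -
  have "odd_fun V mean_trace \<odot> lift V (\<zeta>' i j) \<in> invariants V T p" for i j
  proof (cases p)
    case 0
    then have "\<zeta>' i j = 0" using \<zeta>'[of i j] by (simp add: shifted_def)
    then show ?thesis by (simp add: pullback_zero invariants_zero del: zero_fun_apply)
  next
    case (Suc q)
    then have "\<zeta>' i j \<in> invariants (V \<inter> sl) T q" using \<zeta>'[of i j] by (simp add: shifted_def)
    then show ?thesis
      using invariants_prod[OF odd_fun_mean_trace_invariants lift_invariants] by (simp add: Suc)
  qed
  then have "node_fun V N i j \<odot> (lift V (\<zeta> i j) + odd_fun V mean_trace \<odot> lift V (\<zeta>' i j))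
      \<in> invariants V T (0 + p)" for i j
    using assms(1) by (intro invariants_prod node_fun_invariants invariants_add lift_invariants)
  then show ?thesis
    unfolding synth_def by (intro invariants_sum) (auto split: prod.split)
qed

end

section \<open>Compatibility of the splitting with restriction to a subspace\<close>

lemma restr_sum: "restr W (sum F A) = (\<Sum>a\<in>A. restr W (F a))"
proof (induction A rule: infinite_finite_induct)
  case (insert a A)
  then show ?case by (simp add: restr_add del: plus_fun_apply)
qed (auto simp: restr_def fun_eq_iff)

context
  fixes V W :: "('k::field_char_0, 'n::finite) matrices set"
  assumes V: "central_matspace V" and W: "central_matspace W" and WV: "W \<subseteq> V"
begin

text \<open>The projection \<open>traceless\<close> maps \<open>W\<close> into
  \<open>W \<inter> sl\<close>, so projecting and restricting commute.\<close>

lemma restr_lift: "restr W (lift V \<zeta>) = lift W (restr (W \<inter> sl) \<zeta>)"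
proof -
  have "traceless x \<in> W" "traceless x \<in> sl" if "x \<in> W" for x
    using central_matspace.traceless_in[OF W that] by auto
  then show ?thesis
    using WV by (auto simp: pullback_def restr_def fun_eq_iff subset_iff)
qed

lemma restr_slice: "restr (W \<inter> sl) (slice V i j \<omega>) = slice W i j (restr W \<omega>)"
proof -
  have "x + mscale c (mat 1) \<in> W" if "x \<in> W" for x c
    using W that by (simp add: central_matspace_def matspace_add matspace_scale)
  then show ?thesis
    using WV by (auto simp: slice_def pullback_def restr_def fun_eq_iff)
qed

lemma restr_contract: "restr W (contract (mat 1) \<omega>) = contract (mat 1) (restr W \<omega>)"
  using W by (auto simp: contract_def restr_def fun_eq_iff central_matspace_def)

lemma restr_synth:
  "restr W (synth V N \<zeta> \<zeta>') =
    synth W N (\<lambda>i j. restr (W \<inter> sl) (\<zeta> i j)) (\<lambda>i j. restr (W \<inter> sl) (\<zeta>' i j))"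
proof -
  have "restr W (node_fun V N i j) = node_fun W N i j" for i j
    using WV by (simp add: scalar_fun_def restr_restr Int_absorb2)
  moreover have "restr W (odd_fun V mean_trace) = odd_fun W mean_trace"
    using WV by (simp add: odd_fun_def restr_restr Int_absorb2)
  ultimately show ?thesis
    unfolding synth_def restr_sum
    by (intro sum.cong refl) (simp add: restr_prod restr_add restr_lift split_def del: plus_fun_apply)
qed

end

section \<open>Compatibility of the splitting with the differential\<close>

lemma bracket_sl: "bracket x y \<in> sl"
  by (simp add: bracket_def sl_def trace_sub trace_mul_sym[of x y])

lemma mscale_matrix_mult: "mscale c A ** B = mscale c (A ** B)" "A ** mscale c B = mscale c (A ** B)"
  by (simp_all add: vec_eq_iff matrix_matrix_mult_def sum_distrib_left ac_simps)

lemma matrix_mult_add_left: "((A :: 'a::semiring_1^'n^'m) + B) ** C = A ** C + B ** C"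
  by (simp add: vec_eq_iff matrix_matrix_mult_def distrib_right sum.distrib)

text \<open>Scalar matrices are central; hence the vector inserted by the differential does not
  depend on the even scalar coordinates.\<close>

lemma bracket_scalar_add:
  "bracket (x + mscale a (mat 1)) (y + mscale b (mat 1)) = bracket x y"
  by (simp add: bracket_def matrix_add_ldistrib matrix_mult_add_left mscale_matrix_mult
      mscale_add_right mult.commute)

lemma bracket_traceless: "bracket (traceless x) (traceless y) = bracket x y"
  using bracket_scalar_add[of "traceless x" "mean_trace x" "traceless y" "mean_trace y"]
  by (simp add: traceless_split)

lemma differential_sum: "differential (sum F A) = (\<Sum>a\<in>A. differential (F a))"
proof (induction A rule: infinite_finite_induct)
  case (insert a A)
  then show ?case by (simp add: differential_add del: plus_fun_apply)
qed (auto simp: differential_def fun_eq_iff)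

text \<open>A commutator depends only on the traceless parts of its two arguments and is itself
  fixed by \<open>traceless\<close>, so both sides insert the same matrix.\<close>

lemma differential_lift: "differential (lift UNIV \<zeta>) = lift UNIV (differential \<zeta>)"
  by (simp add: differential_def pullback_def restr_def fun_eq_iff bracket_traceless
      traceless_sl[OF bracket_sl])

lemma differential_slice: "differential (slice UNIV i j \<omega>) = slice UNIV i j (differential \<omega>)"
  by (auto simp: differential_def slice_def pullback_def restr_def fun_eq_iff bracket_scalar_add
      bracket_sl)

text \<open>The differential is contraction with \<open>bracket \<xi> \<eta>\<close> at each point,
  so this is \<open>contract_swap\<close> pointwise.\<close>

lemma differential_contract:
  "\<omega> \<in> superalg V \<Longrightarrow> differential (contract v \<omega>) = - contract v (differential \<omega>)"
  using contract_swap[of \<omega> V _ v]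
  by (simp add: differential_def contract_def fun_eq_iff)

text \<open>All scalar coordinates are cycles: the even ones by degree, the odd one because
  commutators are traceless. The minus sign comes from moving the differential past the odd
  coordinate.\<close>

lemma differential_synth:
  "differential (synth UNIV N \<zeta> \<zeta>') =
    synth UNIV N (\<lambda>i j. differential (\<zeta> i j)) (\<lambda>i j. - differential (\<zeta>' i j))"
proof -
  let ?\<theta> = "odd_fun UNIV mean_trace"
  have node: "differential (node_fun UNIV N i j) = 0" "parity (node_fun UNIV N i j) = node_fun UNIV N i j" for i j
    by (auto simp: differential_def parity_def scalar_fun_def restr_def fun_eq_iff)
  have \<theta>: "differential ?\<theta> = 0" "parity ?\<theta> = - ?\<theta>"
    using mean_trace_sl[OF bracket_sl]
    by (auto simp: differential_def parity_def odd_fun_def restr_def fun_eq_iff)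
  have minus: "lift UNIV (- \<zeta>) = - lift UNIV \<zeta>" for \<zeta> :: "('a, 'b) superfun"
    by (auto simp: pullback_def restr_def fun_eq_iff)
  show ?thesis
    unfolding synth_def differential_sum
    by (intro sum.cong refl)
      (simp add: differential_prod differential_add node \<theta> differential_lift super_prod_minus_left
        super_prod_minus_right minus split_def del: plus_fun_apply)
qed

section \<open>Quasi-isomorphisms onto complexes without differential\<close>

text \<open>The only boundary in the target is 0, so its homology classes are singletons and the
  class of \<open>z\<close> is sent to \<open>{f z}\<close>. The two conditions are surjectivity and
  injectivity on homology.\<close>

lemma quasi_iso_zero_differential_iff:
  fixes f :: "'a::ab_group_add \<Rightarrow> 'b::ab_group_add"
  assumes C: "\<And>p. 0 \<in> C p" "\<And>p x y. x \<in> C p \<Longrightarrow> y \<in> C p \<Longrightarrow> x + y \<in> C p"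
      "\<And>p x. x \<in> C p \<Longrightarrow> - x \<in> C p"
    and d: "\<And>x y. d (x + y) = d x + d y"
    and f: "\<And>x y. f (x + y) = f x + f y"
    and C': "\<And>p. 0 \<in> C' p" "\<And>p x. x \<in> C p \<Longrightarrow> f x \<in> C' p"
    and fd: "\<And>p x. x \<in> C p \<Longrightarrow> f (d x) = 0"
  shows "quasi_iso C d C' (\<lambda>_. 0) f \<longleftrightarrow>
    (\<forall>p. \<forall>w\<in>C' p. \<exists>z\<in>cycles C d p. f z = w) \<and>
    (\<forall>p. \<forall>z\<in>cycles C d p. f z = 0 \<longrightarrow> z \<in> boundaries C d p)"
proof -
  have cm: "chain_map C d C' (\<lambda>_. 0) f"
    using C' fd f by (simp add: chain_map_def)
  have d0: "d 0 = 0" and f0: "f 0 = 0"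
    using d[of 0 0] f[of 0 0] by simp_all
  have dm: "d (- x) = - d x" and fm: "f (- x) = - f x" for x
    using d[of x "- x"] f[of x "- x"] by (simp_all add: d0 f0 eq_neg_iff_add_eq_0 add.commute)
  have B0: "0 \<in> boundaries C d p" for p
    using C(1)[of "Suc p"] d0 by (force simp: boundaries_def)
  have Badd: "x + y \<in> boundaries C d p" if "x \<in> boundaries C d p" "y \<in> boundaries C d p" for x y p
    using that C(2)[of _ "Suc p"] d unfolding boundaries_def by (metis (no_types, lifting) imageE imageI)
  have Bm: "- x \<in> boundaries C d p" if "x \<in> boundaries C d p" for x p
    using that C(3)[of _ "Suc p"] dm unfolding boundaries_def by (metis (no_types, lifting) imageE imageI)
  have fB: "f b = 0" if "b \<in> boundaries C d p" for b p
    using that fd by (auto simp: boundaries_def)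
  have B': "boundaries C' (\<lambda>_. 0) p = {0}" for p
    using C'(1)[of "Suc p"] by (auto simp: boundaries_def)
  have hc': "hclass C' (\<lambda>_. 0) p w = {w}" for p w
    by (simp add: hclass_def B')
  have hom': "homology C' (\<lambda>_. 0) p = (\<lambda>w. {w}) ` C' p" for p
    by (simp add: homology_def hc' cycles_def)
  have ind: "induced C' (\<lambda>_. 0) f p (hclass C d p z) = {f z}" for p z
  proof -
    have "z \<in> hclass C d p z" using B0[of p] by (force simp: hclass_def)
    moreover have "f y = f z" if "y \<in> hclass C d p z" for y
      using that fB by (auto simp: hclass_def f)
    ultimately show ?thesis unfolding induced_def hc' by blast
  qed
  have hc_eq: "hclass C d p x = hclass C d p y \<longleftrightarrow> x - y \<in> boundaries C d p" for p x y
  proof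
    assume "hclass C d p x = hclass C d p y"
    moreover have "x \<in> hclass C d p x" using B0 by (force simp: hclass_def)
    ultimately show "x - y \<in> boundaries C d p" by (auto simp: hclass_def)
  next
    assume xy: "x - y \<in> boundaries C d p"
    have "x + b \<in> hclass C d p y" if "b \<in> boundaries C d p" for b
      using Badd[OF xy that] by (auto simp: hclass_def intro!: exI[of _ "x - y + b"])
    moreover have "y + b \<in> hclass C d p x" if "b \<in> boundaries C d p" for b
      using Badd[OF Bm[OF xy] that] by (auto simp: hclass_def intro!: exI[of _ "- (x - y) + b"])
    ultimately show "hclass C d p x = hclass C d p y" by (auto simp: hclass_def)
  qed
  have Z: "x - y \<in> cycles C d p" if "x \<in> cycles C d p" "y \<in> cycles C d p" for x y p
    using that C(2)[of x p "- y"] C(3)[of y p] d[of x "- y"] by (simp add: cycles_def dm)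
  have "inj_on (induced C' (\<lambda>_. 0) f p) (homology C d p) \<longleftrightarrow>
      (\<forall>z\<in>cycles C d p. f z = 0 \<longrightarrow> z \<in> boundaries C d p)" for p
  proof
    assume inj: "inj_on (induced C' (\<lambda>_. 0) f p) (homology C d p)"
    show "\<forall>z\<in>cycles C d p. f z = 0 \<longrightarrow> z \<in> boundaries C d p"
    proof (intro ballI impI)
      fix z assume z: "z \<in> cycles C d p" "f z = 0"
      have "0 \<in> cycles C d p" by (simp add: cycles_def C d0)
      then have "hclass C d p z = hclass C d p 0"
        using z by (intro inj_onD[OF inj]) (auto simp: ind f0 homology_def)
      then show "z \<in> boundaries C d p" by (simp add: hc_eq)
    qed
  next
    assume *: "\<forall>z\<in>cycles C d p. f z = 0 \<longrightarrow> z \<in> boundaries C d p"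
    have "x - y \<in> boundaries C d p" if "x \<in> cycles C d p" "y \<in> cycles C d p" "f x = f y" for x y
      using * Z[OF that(1,2)] f[of x "- y"] that(3) by (simp add: fm)
    then show "inj_on (induced C' (\<lambda>_. 0) f p) (homology C d p)"
      by (auto simp: inj_on_def homology_def ind hc_eq)
  qed
  moreover have "induced C' (\<lambda>_. 0) f p ` homology C d p = homology C' (\<lambda>_. 0) p \<longleftrightarrow>
      (\<forall>w\<in>C' p. \<exists>z\<in>cycles C d p. f z = w)" for p
  proof -
    have "induced C' (\<lambda>_. 0) f p ` homology C d p = (\<lambda>w. {w}) ` f ` cycles C d p"
      by (simp add: homology_def image_image ind)
    moreover have "f ` cycles C d p \<subseteq> C' p" using C'(2) by (auto simp: cycles_def)
    moreover have "inj (\<lambda>w :: 'b. {w})" by (simp add: inj_def)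
    ultimately have "induced C' (\<lambda>_. 0) f p ` homology C d p = homology C' (\<lambda>_. 0) p \<longleftrightarrow>
        C' p \<subseteq> f ` cycles C d p"
      by (auto simp: hom' inj_image_eq_iff)
    then show ?thesis by (auto simp: subset_iff image_iff eq_commute)
  qed
  ultimately show ?thesis by (auto simp: quasi_iso_def cm bij_betw_def)
qed

section \<open>The adjoint action\<close>

lemma matrix_inv_inverse:
  fixes g :: "'a::semiring_1^'n::finite^'n"
  assumes "invertible g" shows "g ** matrix_inv g = mat 1" "matrix_inv g ** g = mat 1"
proof -
  have "g ** matrix_inv g = mat 1 \<and> matrix_inv g ** g = mat 1"
    using assms unfolding invertible_def matrix_inv_def by (rule someI_ex)
  then show "g ** matrix_inv g = mat 1" "matrix_inv g ** g = mat 1" by auto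
qed

lemma matrix_inv_eqI:
  fixes g h :: "'a::semiring_1^'n::finite^'n"
  assumes "g ** h = mat 1" "h ** g = mat 1" shows "matrix_inv g = h"
proof -
  have "invertible g" using assms by (auto simp: invertible_def)
  then have "matrix_inv g = matrix_inv g ** (g ** h)" "h = (matrix_inv g ** g) ** h"
    using assms by (simp_all add: matrix_inv_inverse)
  then show ?thesis by (simp add: matrix_mul_assoc)
qed

lemma SL_subset_GL: "(SL :: ('k::field, 'n::finite) matrices set) \<subseteq> GL"
  by (auto simp: SL_def GL_def invertible_det_nz)

lemma Ad_mono: "G \<subseteq> H \<Longrightarrow> Ad G \<subseteq> Ad H"
  by (auto simp: Ad_def)

lemma central_matspace_UNIV: "central_matspace UNIV"
  by unfold_locales (simp_all add: matspace_def)

lemma central_action_Ad: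
  fixes G :: "('k::field_char_0, 'n::finite) matrices set"
  assumes "G \<subseteq> GL" shows "central_action UNIV (Ad G)"
proof -
  interpret central_matspace "UNIV :: ('k, 'n) matrices set" by (rule central_matspace_UNIV)
  show ?thesis
  proof
    fix \<tau> :: "('k, 'n) matrices \<Rightarrow> ('k, 'n) matrices" and x y c assume "\<tau> \<in> Ad G"
    then obtain g where g: "invertible g" "\<tau> = (\<lambda>x. g ** x ** matrix_inv g)"
      using assms by (auto simp: Ad_def GL_def)
    show "\<tau> (x + y) = \<tau> x + \<tau> y"
      by (simp add: g(2) matrix_add_ldistrib matrix_mult_add_left)
    show "\<tau> (mscale c x) = mscale c (\<tau> x)"
      by (simp add: g(2) mscale_matrix_mult)
    show "\<tau> (mat 1) = mat 1"
      by (simp add: g matrix_inv_inverse)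
    have "trace (g ** x ** matrix_inv g) = trace (matrix_inv g ** g ** x)"
      by (simp add: trace_mul_sym[of "g ** x"] matrix_mul_assoc)
    then show "trace (\<tau> x) = trace x"
      by (simp add: g matrix_inv_inverse)
  qed simp
qed

section \<open>Invariance under SL and GL\<close>

definition diag_matrix :: "('n \<Rightarrow> 'k::field) \<Rightarrow> ('k, 'n::finite) matrices" where
  "diag_matrix v = (\<chi> i j. if i = j then v i else 0)"

lemma diag_matrix_mult: "diag_matrix v ** A = (\<chi> i j. v i * A $ i $ j)"
  "A ** diag_matrix v = (\<chi> i j. A $ i $ j * v j)"
  by (simp_all add: diag_matrix_def matrix_matrix_mult_def vec_eq_iff if_distrib
      if_distribR sum.delta cong: if_cong)

lemma det_diag_matrix: "det (diag_matrix v) = (\<Prod>i\<in>UNIV. v i)"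
  by (subst det_diagonal) (simp_all add: diag_matrix_def)

lemma diag_matrix_inverse:
  "(\<And>i. v i \<noteq> 0) \<Longrightarrow> diag_matrix v ** diag_matrix (\<lambda>i. inverse (v i)) = mat 1"
  by (simp add: diag_matrix_mult) (simp add: diag_matrix_def mat_def vec_eq_iff)

lemma matrix_inv_diag_matrix:
  assumes "\<And>i. v i \<noteq> 0" shows "matrix_inv (diag_matrix v) = diag_matrix (\<lambda>i. inverse (v i))"
  using diag_matrix_inverse[of v] diag_matrix_inverse[of "\<lambda>i. inverse (v i)"] assms
  by (intro matrix_inv_eqI) simp_all

lemma Ad_diag_matrix:
  assumes "\<And>i. v i \<noteq> 0"
  shows "diag_matrix v ** x ** matrix_inv (diag_matrix v) = (\<chi> i j. v i * x $ i $ j / v j)"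
  by (simp add: matrix_inv_diag_matrix[OF assms] diag_matrix_mult divide_inverse)

text \<open>Laurent polynomials as functions on the nonzero scalars, with \<open>t ^ N\<close>
  clearing the poles; the value at 0 is left open.\<close>

definition laurent :: "('k::field \<Rightarrow> 'k) \<Rightarrow> bool" where
  "laurent f \<longleftrightarrow> (\<exists>N p. \<forall>t. t \<noteq> 0 \<longrightarrow> t ^ N * f t = poly p t)"

lemma laurent_const: "laurent (\<lambda>t. c)"
  and laurent_id: "laurent (\<lambda>t. t)"
  and laurent_inverse: "laurent inverse"
proof -
  show "laurent (\<lambda>t. c)" unfolding laurent_def by (intro exI[of _ 0] exI[of _ "[:c:]"]) simp
  show "laurent (\<lambda>t. t)" unfolding laurent_def by (intro exI[of _ 0] exI[of _ "[:0, 1:]"]) simp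
  show "laurent inverse" unfolding laurent_def by (intro exI[of _ 1] exI[of _ "[:1:]"]) simp
qed

lemma laurent_add: assumes "laurent f" "laurent g" shows "laurent (\<lambda>t. f t + g t)"
proof -
  obtain M N p q where *: "\<And>t. t \<noteq> 0 \<Longrightarrow> t ^ M * f t = poly p t" "\<And>t. t \<noteq> 0 \<Longrightarrow> t ^ N * g t = poly q t"
    using assms unfolding laurent_def by metis
  have "t ^ (M + N) * (f t + g t) = poly (monom 1 N * p + monom 1 M * q) t" if "t \<noteq> 0" for t
    by (simp add: poly_monom power_add algebra_simps flip: *[OF that])
  then show ?thesis unfolding laurent_def by blast
qed

lemma laurent_mult: assumes "laurent f" "laurent g" shows "laurent (\<lambda>t. f t * g t)"
proof -
  obtain M N p q where *: "\<And>t. t \<noteq> 0 \<Longrightarrow> t ^ M * f t = poly p t" "\<And>t. t \<noteq> 0 \<Longrightarrow> t ^ N * g t = poly q t"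
    using assms unfolding laurent_def by metis
  have "t ^ (M + N) * (f t * g t) = poly (p * q) t" if "t \<noteq> 0" for t
    by (simp add: power_add ac_simps flip: *[OF that])
  then show ?thesis unfolding laurent_def by blast
qed

lemma laurent_sum: "(\<And>a. a \<in> A \<Longrightarrow> laurent (F a)) \<Longrightarrow> laurent (\<lambda>t. \<Sum>a\<in>A. F a t)"
  by (induction A rule: infinite_finite_induct) (simp_all add: laurent_const laurent_add)

text \<open>In characteristic 0 the n-th powers \<open>(2 ^ m) ^ n\<close> are infinitely many, and
  the polynomial left after clearing the pole agrees on all of them with \<open>f 1\<close> times a
  power of the variable. No root of \<open>t\<close> is ever extracted.\<close>

lemma laurent_constant:
  fixes f :: "'k::field_char_0 \<Rightarrow> 'k"
  assumes "laurent f" "0 < n" and f: "\<And>s. s \<noteq> 0 \<Longrightarrow> f (s ^ n) = f 1" and "t \<noteq> 0"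
  shows "f t = f 1"
proof -
  obtain N p where p: "\<And>t. t \<noteq> 0 \<Longrightarrow> t ^ N * f t = poly p t"
    using assms(1) unfolding laurent_def by blast
  define q where "q = p - monom (f 1) N"
  have "poly q ((2 ^ m) ^ n) = 0" for m
    using p[of "(2 ^ m) ^ n"] f[of "2 ^ m"] by (simp add: q_def poly_monom mult.commute)
  then have sub: "range (\<lambda>m. (2 ^ m) ^ n) \<subseteq> {x. poly q x = 0}" by auto
  have "inj (\<lambda>m. (2 ^ m) ^ n :: 'k)"
  proof (rule injI)
    fix k m assume "(2 ^ k) ^ n = ((2 ^ m) ^ n :: 'k)"
    then have "of_nat (2 ^ (k * n)) = (of_nat (2 ^ (m * n)) :: 'k)" by (simp add: power_mult)
    then have "(2::nat) ^ (k * n) = 2 ^ (m * n)" by (simp only: of_nat_eq_iff)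
    then show "k = m" using \<open>0 < n\<close> by simp
  qed
  then have "infinite {x. poly q x = 0}"
    using sub by (meson finite_subset range_inj_infinite)
  then have "q = 0" using poly_roots_finite by blast
  then have "t ^ N * f t = t ^ N * f 1"
    using p[OF \<open>t \<noteq> 0\<close>] by (simp add: q_def poly_monom)
  then show ?thesis using \<open>t \<noteq> 0\<close> by simp
qed

definition torus_vec :: "'n \<Rightarrow> 'k \<Rightarrow> 'n \<Rightarrow> 'k::field" where
  "torus_vec i\<^sub>0 t i = (if i = i\<^sub>0 then t else 1)"

definition torus_act :: "'n \<Rightarrow> 'k \<Rightarrow> ('k::field, 'n::finite) matrices \<Rightarrow> ('k, 'n) matrices" where
  "torus_act i\<^sub>0 t x = (\<chi> i j. torus_vec i\<^sub>0 t i * x $ i $ j / torus_vec i\<^sub>0 t j)"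

lemma laurent_dual:
  assumes "\<phi> \<in> dual UNIV" shows "laurent (\<lambda>t. \<phi> (torus_act i\<^sub>0 t x))"
proof -
  \<comment> \<open>Weight decomposition under the one-parameter torus: \<open>A\<close>,
    \<open>B\<close> and \<open>C\<close> are the parts of weight 0, 1 and -1.\<close>
  define A where "A = (\<chi> i j. if (i = i\<^sub>0) = (j = i\<^sub>0) then x $ i $ j else 0)"
  define B where "B = (\<chi> i j. if i = i\<^sub>0 \<and> j \<noteq> i\<^sub>0 then x $ i $ j else 0)"
  define C where "C = (\<chi> i j. if i \<noteq> i\<^sub>0 \<and> j = i\<^sub>0 then x $ i $ j else 0)"
  have "t * (\<phi> (torus_act i\<^sub>0 t x)) = t * (\<phi> A + t * \<phi> B + inverse t * \<phi> C)" if "t \<noteq> 0" for t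
  proof -
    have "torus_act i\<^sub>0 t x = A + mscale t B + mscale (inverse t) C"
      using that by (simp add: torus_act_def torus_vec_def A_def B_def C_def vec_eq_iff divide_inverse)
    then show ?thesis using assms by (simp add: dual_add dual_scale)
  qed
  moreover have "laurent (\<lambda>t. \<phi> A + t * \<phi> B + inverse t * \<phi> C)"
    by (intro laurent_add laurent_mult laurent_const laurent_id laurent_inverse)
  ultimately show ?thesis unfolding laurent_def by (metis (no_types) mult_left_cancel)
qed

lemma laurent_superalg:
  assumes "\<omega> \<in> superalg UNIV"
  shows "laurent (\<lambda>t. \<omega> (torus_act i\<^sub>0 t \<xi>) (torus_act i\<^sub>0 t \<eta>) (map (torus_act i\<^sub>0 t) vs))"
  using assms
proof (induction arbitrary: vs rule: superalg.induct)
  case (const c)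
  then show ?case by (simp add: const_fun_def restr_def laurent_const)
next
  case (fst \<phi>)
  then show ?case
    by (cases "vs = []") (simp_all add: fst_fun_def restr_def laurent_const laurent_dual)
next
  case (snd \<phi>)
  then show ?case
    by (cases "vs = []") (simp_all add: snd_fun_def restr_def laurent_const laurent_dual)
next
  case (odd \<phi>)
  then show ?case
    by (cases vs; cases "tl vs") (simp_all add: odd_fun_def restr_def laurent_const laurent_dual)
next
  case (add \<alpha> \<beta>)
  then show ?case by (simp add: laurent_add)
next
  case (prod \<alpha> \<beta>)
  then show ?case
    by (simp add: super_prod_def nths_map) (intro laurent_sum laurent_mult laurent_const; simp)
qed

text \<open>
  The torus element \<open>diag(s\<^sup>n, 1, \<dots>, 1)\<close> acts like a rescaling of determinant 1, so a Laurent
  polynomial in \<open>t\<close> that describes the action of \<open>diag(t, 1, \<dots>, 1)\<close> is constant on \<open>n\<close>-th powers.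
\<close>

lemma invariant_SL_imp_GL:
  fixes \<omega> :: "('k::field_char_0, 'n::finite) superfun"
  assumes \<omega>: "\<omega> \<in> superalg UNIV" and inv: "invariant_under (Ad SL) \<omega>"
  shows "invariant_under (Ad GL) \<omega>"
  unfolding invariant_under_def
proof (intro ballI allI)
  fix \<tau> :: "('k, 'n) matrices \<Rightarrow> ('k, 'n) matrices" and \<xi> \<eta> vs
  assume "\<tau> \<in> Ad GL"
  then obtain g where g: "invertible g" "\<tau> = (\<lambda>x. g ** x ** matrix_inv g)"
    by (auto simp: Ad_def GL_def)
  define i\<^sub>0 :: 'n where "i\<^sub>0 = undefined"
  let ?v = "torus_vec i\<^sub>0 :: 'k \<Rightarrow> 'n \<Rightarrow> 'k" and ?act = "torus_act i\<^sub>0 :: 'k \<Rightarrow> ('k, 'n) matrices \<Rightarrow> _"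
  have v: "?v t i \<noteq> 0" if "t \<noteq> 0" for t i using that by (simp add: torus_vec_def)
  have det_v: "det (diag_matrix (?v t)) = t" for t
    by (simp add: det_diag_matrix torus_vec_def)
  have SL_inv: "\<omega> (h ** x ** matrix_inv h) (h ** y ** matrix_inv h) (map (\<lambda>x. h ** x ** matrix_inv h) us) = \<omega> x y us"
    if "det h = 1" for h x y us
  proof -
    have "(\<lambda>x. h ** x ** matrix_inv h) \<in> Ad SL" using that by (auto simp: Ad_def SL_def)
    from bspec[OF inv[unfolded invariant_under_def] this] show ?thesis by simp
  qed
  have torus: "\<omega> (?act t x) (?act t y) (map (?act t) us) = \<omega> x y us" if "t \<noteq> 0" for t x y us
  proof -
    have act_1: "?act 1 = (\<lambda>x. x)"
      by (simp add: torus_act_def torus_vec_def vec_eq_iff fun_eq_iff)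
    have power: "\<omega> (?act (s ^ CARD('n)) x) (?act (s ^ CARD('n)) y) (map (?act (s ^ CARD('n))) us) = \<omega> x y us"
      if "s \<noteq> 0" for s
    proof -
      \<comment> \<open>Dividing by \<open>s\<close> changes the matrix by a scalar, hence not the
        conjugation, and brings the determinant from \<open>s ^ CARD('n)\<close> down to 1.\<close>
      let ?h = "diag_matrix (\<lambda>i. ?v (s ^ CARD('n)) i / s)"
      have nz: "?v (s ^ CARD('n)) i / s \<noteq> 0" for i using that v by simp
      have "det ?h = 1"
        using that det_v[of "s ^ CARD('n)"] by (simp add: det_diag_matrix prod_dividef)
      moreover have "?h ** z ** matrix_inv ?h = ?act (s ^ CARD('n)) z" for z
        using that by (subst Ad_diag_matrix[OF nz]) (simp add: torus_act_def vec_eq_iff)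
      ultimately show ?thesis using SL_inv[of ?h x y us] by simp
    qed
    show ?thesis
      using laurent_constant[OF laurent_superalg[OF \<omega>] zero_less_card_finite[where ?'a = 'n] _ that,
          of i\<^sub>0 x y us] power
      by (simp add: act_1)
  qed
  \<comment> \<open>A general \<open>g\<close> is split as \<open>h ** d\<close>, with
    \<open>d\<close> the torus element of determinant \<open>det g\<close>, so that \<open>h\<close>
    lies in \<open>SL\<close>.\<close>
  define D where "D = det g"
  have D: "D \<noteq> 0" using g(1) by (simp add: D_def invertible_det_nz)
  define d where "d = diag_matrix (?v D)"
  define h where "h = g ** matrix_inv d"
  have d: "invertible d" using det_v[of D] D by (simp add: d_def invertible_det_nz)
  have gh: "g = h ** d"
    by (simp add: h_def matrix_inv_inverse(2)[OF d] flip: matrix_mul_assoc)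
  have "det g = det h * det d" by (simp add: gh det_mul)
  then have det_h: "det h = 1" using det_v[of D] D by (simp add: d_def D_def)
  then have h: "invertible h" by (simp add: invertible_det_nz)
  have "matrix_inv g = matrix_inv d ** matrix_inv h"
  proof (rule matrix_inv_eqI)
    have "g ** (matrix_inv d ** matrix_inv h) = h ** (d ** matrix_inv d) ** matrix_inv h"
      by (simp add: gh matrix_mul_assoc)
    then show "g ** (matrix_inv d ** matrix_inv h) = mat 1"
      by (simp add: matrix_inv_inverse d h)
    have "(matrix_inv d ** matrix_inv h) ** g = matrix_inv d ** (matrix_inv h ** h) ** d"
      by (simp add: gh matrix_mul_assoc)
    then show "(matrix_inv d ** matrix_inv h) ** g = mat 1"
      by (simp add: matrix_inv_inverse d h)
  qed
  then have "\<tau> x = h ** (d ** x ** matrix_inv d) ** matrix_inv h" for x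
    by (simp add: g(2) gh matrix_mul_assoc)
  moreover have "d ** x ** matrix_inv d = ?act D x" for x
    unfolding d_def by (subst Ad_diag_matrix[OF v[OF D]]) (simp add: torus_act_def)
  ultimately have \<tau>: "\<tau> = (\<lambda>x. h ** ?act D x ** matrix_inv h)" by (simp add: fun_eq_iff)
  have "\<omega> (\<tau> \<xi>) (\<tau> \<eta>) (map \<tau> vs) = \<omega> (h ** ?act D \<xi> ** matrix_inv h) (h ** ?act D \<eta> ** matrix_inv h)
      (map (\<lambda>x. h ** x ** matrix_inv h) (map (?act D) vs))"
    by (simp add: \<tau> comp_def)
  also have "\<dots> = \<omega> \<xi> \<eta> vs"
    by (simp only: SL_inv[OF det_h] torus[OF D])
  finally show "\<omega> (\<tau> \<xi>) (\<tau> \<eta>) (map \<tau> vs) = \<omega> \<xi> \<eta> vs" .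
qed

text \<open>The projection \<open>traceless\<close> fixes traceless matrices. This is the retraction
  that splits the \<open>sl\<close> complex off the \<open>gl\<close> complex.\<close>

lemma (in central_matspace) slice_lift:
  assumes "\<zeta> \<in> superalg (V \<inter> sl)" shows "slice V 0 0 (lift V \<zeta>) = \<zeta>"
proof -
  have "map traceless vs = vs" if "set vs \<subseteq> sl" for vs :: "('k, 'n) matrices list"
    using that by (intro map_idI) (auto simp: traceless_sl)
  then have "slice V 0 0 (lift V \<zeta>) = restr (V \<inter> sl) \<zeta>"
    by (auto simp: slice_def pullback_def restr_def fun_eq_iff traceless_sl)
  then show ?thesis by (simp add: restr_superalg assms)
qed

text \<open>\<open>invariant_SL_imp_GL\<close> speaks of forms on all matrices, so a form on
  \<open>sl\<close> is pulled back along \<open>traceless\<close>, seen to be GL-invariant there,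
  and cut back to the slice at the node \<open>(0, 0)\<close>.\<close>

lemma invariants_SL_eq_GL:
  "invariants (sl :: ('k::field_char_0, 'n::finite) matrices set) (Ad SL) p = invariants sl (Ad GL) p"
proof
  interpret S: central_action "UNIV :: ('k, 'n) matrices set" "Ad SL"
    by (rule central_action_Ad[OF SL_subset_GL])
  interpret G: central_action "UNIV :: ('k, 'n) matrices set" "Ad GL"
    by (rule central_action_Ad) simp
  show "invariants sl (Ad SL) p \<subseteq> (invariants sl (Ad GL) p :: ('k, 'n) superfun set)"
  proof
    fix \<omega> :: "('k, 'n) superfun" assume "\<omega> \<in> invariants sl (Ad SL) p"
    then have \<omega>: "\<omega> \<in> superalg sl" "hom_degree p \<omega>" "invariant_under (Ad SL) \<omega>"
      by (simp_all add: invariants_iff)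
    then have "invariant_under (Ad GL) (lift UNIV \<omega>)"
      using S.lift_superalg[of \<omega>] S.invariant_lift by (intro invariant_SL_imp_GL) simp_all
    then have "invariant_under (Ad GL) (slice UNIV 0 0 (lift UNIV \<omega>))"
      by (rule G.invariant_slice)
    then show "\<omega> \<in> invariants sl (Ad GL) p"
      using \<omega> S.slice_lift[of \<omega>] by (simp add: invariants_iff)
  qed
  show "invariants sl (Ad GL) p \<subseteq> (invariants sl (Ad SL) p :: ('k, 'n) superfun set)"
    using Ad_mono[OF SL_subset_GL] by (auto simp: invariants_def)
qed

section \<open>The Harish-Chandra homomorphism\<close>

abbreviation diagonals :: "('k::field, 'n::finite) matrices set" where
  "diagonals \<equiv> cartan gl"

lemma cartan_eq: "cartan V = V \<inter> diagonals"
  by (auto simp: cartan_def gl_def)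

text \<open>Permuting rows and columns is conjugation by a permutation matrix \<open>P\<close> with
  inverse \<open>Q\<close>. Its determinant can be -1, which is why \<open>GL\<close> appears rather
  than \<open>SL\<close>.\<close>

lemma weyl_subset_Ad: "(weyl :: (('k::field, 'n::finite) matrices \<Rightarrow> _) set) \<subseteq> Ad GL"
proof
  fix \<tau> :: "('k, 'n) matrices \<Rightarrow> ('k, 'n) matrices" assume "\<tau> \<in> weyl"
  then obtain \<sigma> :: "'n \<Rightarrow> 'n" where \<sigma>: "bij \<sigma>" "\<tau> = (\<lambda>x. \<chi> i j. x $ \<sigma> i $ \<sigma> j)"
    by (auto simp: weyl_def)
  define P Q :: "('k, 'n) matrices" where "P = (\<chi> i j. if j = \<sigma> i then 1 else 0)"
    and "Q = (\<chi> i j. if i = \<sigma> j then 1 else 0)"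
  have P: "P ** A = (\<chi> i j. A $ \<sigma> i $ j)" for A
    by (simp add: P_def matrix_matrix_mult_def vec_eq_iff mult_delta_left)
  have Q: "A ** Q = (\<chi> i j. A $ i $ \<sigma> j)" for A
    by (simp add: Q_def matrix_matrix_mult_def vec_eq_iff mult_delta_right)
  have PQ: "P ** Q = mat 1"
    using \<sigma>(1) by (simp add: P) (simp add: Q_def mat_def vec_eq_iff bij_def inj_eq)
  then have QP: "Q ** P = mat 1" by (simp add: matrix_left_right_inverse)
  have "matrix_inv P = Q" using PQ QP by (rule matrix_inv_eqI)
  then have "\<tau> = (\<lambda>x. P ** x ** matrix_inv P)"
    by (simp add: \<sigma>(2) P Q)
  moreover have "P \<in> GL" using PQ QP by (auto simp: GL_def invertible_def)
  ultimately show "\<tau> \<in> Ad GL" by (auto simp: Ad_def)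
qed

lemma central_matspace_diagonals: "central_matspace (diagonals :: ('k::field_char_0, 'n::finite) matrices set)"
  by unfold_locales (auto simp: matspace_def cartan_def gl_def mat_def)

lemma weyl_diagonals:
  assumes "\<tau> \<in> weyl" shows "\<tau> x \<in> diagonals \<longleftrightarrow> x \<in> diagonals"
proof -
  obtain \<sigma> where \<sigma>: "bij \<sigma>" "\<tau> = (\<lambda>x. \<chi> i j. x $ \<sigma> i $ \<sigma> j)"
    using assms by (auto simp: weyl_def)
  have "(\<forall>i j. i \<noteq> j \<longrightarrow> x $ \<sigma> i $ \<sigma> j = 0) \<longleftrightarrow> (\<forall>i j. i \<noteq> j \<longrightarrow> x $ i $ j = 0)"
    by (metis \<sigma>(1) bij_pointE)
  then show ?thesis by (simp add: \<sigma>(2) cartan_def gl_def)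
qed

lemma central_action_weyl:
  "central_action (diagonals :: ('k::field_char_0, 'n::finite) matrices set) weyl"
proof -
  interpret G: central_action "UNIV :: ('k, 'n) matrices set" "Ad GL"
    by (rule central_action_Ad) simp
  interpret central_matspace "diagonals :: ('k, 'n) matrices set" by (rule central_matspace_diagonals)
  show ?thesis
    using weyl_subset_Ad[where ?'k = 'k and ?'n = 'n]
    by unfold_locales
      (auto simp: G.action_add G.action_scale G.action_mat_1 G.action_trace weyl_diagonals subset_iff)
qed

lemma restr_diagonals_invariants:
  fixes V :: "('k::field_char_0, 'n::finite) matrices set"
  assumes "matspace V" "\<And>\<tau> x. \<tau> \<in> weyl \<Longrightarrow> \<tau> x \<in> V \<longleftrightarrow> x \<in> V" and \<omega>: "\<omega> \<in> invariants V (Ad GL) p"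
  shows "restr (V \<inter> diagonals) \<omega> \<in> invariants (V \<inter> diagonals) weyl p"
proof -
  interpret W: central_action "diagonals :: ('k, 'n) matrices set" weyl by (rule central_action_weyl)
  have "restr (V \<inter> diagonals) \<omega> \<in> superalg (V \<inter> diagonals)"
    using \<omega> assms(1) W.V by (intro restr_in_superalg[of _ V]) (auto simp: invariants_iff matspace_Int)
  moreover have "invariant_under weyl (restr (V \<inter> diagonals) \<omega>)"
    unfolding invariant_under_def
  proof (intro ballI allI)
    fix \<tau> :: "('k, 'n) matrices \<Rightarrow> ('k, 'n) matrices" and \<xi> \<eta> vs assume \<tau>: "\<tau> \<in> weyl"
    have "\<tau> x \<in> V \<inter> diagonals \<longleftrightarrow> x \<in> V \<inter> diagonals" for x
      using assms(2)[OF \<tau>] weyl_diagonals[OF \<tau>] by auto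
    moreover from this have "set (map \<tau> vs) \<subseteq> V \<inter> diagonals \<longleftrightarrow> set vs \<subseteq> V \<inter> diagonals"
      by (auto simp only: set_map image_subset_iff)
    moreover have "\<omega> (\<tau> \<xi>) (\<tau> \<eta>) (map \<tau> vs) = \<omega> \<xi> \<eta> vs"
      using \<omega> \<tau> weyl_subset_Ad unfolding invariants_iff invariant_under_def by blast
    ultimately show "restr (V \<inter> diagonals) \<omega> (\<tau> \<xi>) (\<tau> \<eta>) (map \<tau> vs) = restr (V \<inter> diagonals) \<omega> \<xi> \<eta> vs"
      unfolding restr_def by (simp only:)
  qed
  ultimately show ?thesis
    using \<omega> by (simp add: invariants_iff hom_degree_restr)
qed

lemma bracket_diagonals:
  fixes x y :: "('k::field, 'n::finite) matrices"
  assumes "x \<in> diagonals" "y \<in> diagonals" shows "bracket x y = 0"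
proof -
  have "z = diag_matrix (\<lambda>i. z $ i $ i)" if "z \<in> diagonals" for z :: "('k, 'n) matrices"
    using that by (auto simp: cartan_def diag_matrix_def vec_eq_iff)
  with assms have "x = diag_matrix (\<lambda>i. x $ i $ i)" "y = diag_matrix (\<lambda>i. y $ i $ i)" by auto
  moreover have "bracket (diag_matrix u) (diag_matrix v) = 0" for u v :: "'n \<Rightarrow> 'k"
    by (simp add: bracket_def diag_matrix_mult vec_eq_iff) (simp add: diag_matrix_def)
  ultimately show ?thesis by metis
qed

text \<open>Diagonal matrices commute, so the differential inserts the zero matrix, on which a form
  vanishes by linearity. This makes restriction a chain map to a complex with zero
  differential.\<close>

lemma restr_diagonals_differential:
  assumes "matspace V" "\<omega> \<in> superalg V"
  shows "restr (V \<inter> diagonals) (differential \<omega>) = 0"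
proof -
  have "\<omega> \<xi> \<eta> (0 # vs) = 0" for \<xi> \<eta> vs
    using contract_zero[OF assms] by (simp add: contract_def fun_eq_iff)
  then show ?thesis by (auto simp: restr_def differential_def bracket_diagonals fun_eq_iff)
qed

text \<open>Expressed through \<open>GL\<close>-invariants for either group, so that the
  \<open>sl\<close> and \<open>gl\<close> sides are comparable and
  \<open>restr_diagonals_invariants\<close> applies to both.\<close>

lemma harish_chandra_iff:
  fixes V :: "('k::field_char_0, 'n::finite) matrices set"
  assumes "matspace V" "\<And>\<tau> x. \<tau> \<in> weyl \<Longrightarrow> \<tau> x \<in> V \<longleftrightarrow> x \<in> V"
    and G: "\<And>p. invariants V (Ad G) p = invariants V (Ad GL) p"
  shows "harish_chandra_quasi_iso V G \<longleftrightarrow>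
    (\<forall>p. \<forall>w\<in>invariants (V \<inter> diagonals) weyl p.
       \<exists>z\<in>cycles (invariants V (Ad GL)) differential p. restr (V \<inter> diagonals) z = w) \<and>
    (\<forall>p. \<forall>z\<in>cycles (invariants V (Ad GL)) differential p.
       restr (V \<inter> diagonals) z = 0 \<longrightarrow> z \<in> boundaries (invariants V (Ad GL)) differential p)"
proof -
  have "invariants V (Ad G) = invariants V (Ad GL)" using G by (rule ext)
  then show ?thesis
    unfolding harish_chandra_quasi_iso_def harish_chandra_def cartan_eq[of V]
    by (simp only:) (rule quasi_iso_zero_differential_iff;
      (rule invariants_zero invariants_add invariants_uminus differential_add restr_add
        restr_diagonals_invariants restr_diagonals_differential assms | assumption
        | simp add: invariants_iff assms)+)
qed

lemma synth_zero: "synth V N (\<lambda>_ _. 0) (\<lambda>_ _. 0) = 0"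
proof -
  have "lift V 0 = 0" by (auto simp: pullback_def restr_def fun_eq_iff)
  then show ?thesis unfolding synth_def by (simp del: zero_fun_apply plus_fun_apply)
qed

theorem theorem8p1:
  assumes "CARD('n::finite) \<ge> 2"
  shows "harish_chandra_quasi_iso (sl :: ('k::field_char_0, 'n) matrices set) SL
     \<longleftrightarrow> harish_chandra_quasi_iso (gl :: ('k, 'n) matrices set) GL"
proof -
  let ?D = "diagonals :: ('k, 'n) matrices set" and ?d = "differential :: ('k, 'n) superfun \<Rightarrow> _"
  let ?Cs = "invariants (sl :: ('k, 'n) matrices set) (Ad GL)"
  let ?Cg = "invariants (UNIV :: ('k, 'n) matrices set) (Ad GL)"
  let ?Hs = "invariants (?D \<inter> sl) weyl" and ?Hg = "invariants ?D weyl"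
  interpret G: central_action "UNIV :: ('k, 'n) matrices set" "Ad GL"
    by (rule central_action_Ad) simp
  interpret W: central_action ?D weyl by (rule central_action_weyl)
  have weyl_sl: "\<tau> x \<in> sl \<longleftrightarrow> x \<in> sl" if "\<tau> \<in> weyl" for \<tau> and x :: "('k, 'n) matrices"
    using W.action_sl[OF that] .
  note G_slice = G.slice_invariants[unfolded Int_UNIV_left]
  note G_slice' = G.contract_slice_invariants[unfolded Int_UNIV_left]
  note G_lift = G.lift_invariants[unfolded Int_UNIV_left]
  note G_synth = G.synth_invariants[unfolded Int_UNIV_left]
  note compat = G.central_matspace_axioms W.central_matspace_axioms subset_UNIV
  have d_zero: "?d 0 = 0" by (simp add: differential_def fun_eq_iff)
  have slice_zero: "slice V i j (0 :: ('k, 'n) superfun) = 0" for V i j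
    by (simp add: slice_def pullback_zero)
  have lift_zero: "lift V (0 :: ('k, 'n) superfun) = 0" for V
    by (simp add: pullback_zero)
  have restr_zero: "restr V (0 :: ('k, 'n) superfun) = 0" for V
    by (auto simp: restr_def fun_eq_iff)
  have restr_uminus: "restr V (- \<omega>) = - restr V \<omega>" for V and \<omega> :: "('k, 'n) superfun"
    by (auto simp: restr_def fun_eq_iff)
  have d_uminus: "?d (- \<omega>) = - ?d \<omega>" for \<omega>
    by (simp add: differential_def fun_eq_iff)
  have contract_of_zero: "contract v (0 :: ('k, 'n) superfun) = 0" for v
    by (simp add: contract_def fun_eq_iff)
  have sl_iff: "harish_chandra_quasi_iso (sl :: ('k, 'n) matrices set) SL \<longleftrightarrow>
    (\<forall>p. \<forall>w\<in>?Hs p. \<exists>z\<in>cycles ?Cs ?d p. restr (?D \<inter> sl) z = w) \<and>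
    (\<forall>p. \<forall>z\<in>cycles ?Cs ?d p. restr (?D \<inter> sl) z = 0 \<longrightarrow> z \<in> boundaries ?Cs ?d p)"
    unfolding Int_commute[of ?D]
    by (rule harish_chandra_iff) (simp_all add: matspace_sl weyl_sl invariants_SL_eq_GL)
  have gl_iff: "harish_chandra_quasi_iso (gl :: ('k, 'n) matrices set) GL \<longleftrightarrow>
    (\<forall>p. \<forall>w\<in>?Hg p. \<exists>z\<in>cycles ?Cg ?d p. restr ?D z = w) \<and>
    (\<forall>p. \<forall>z\<in>cycles ?Cg ?d p. restr ?D z = 0 \<longrightarrow> z \<in> boundaries ?Cg ?d p)"
    using harish_chandra_iff[of "UNIV :: ('k, 'n) matrices set" GL] G.V by (simp add: gl_def)
  show ?thesis
  proof
    assume *: "harish_chandra_quasi_iso (sl :: ('k, 'n) matrices set) SL"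
    have surj: "\<exists>z\<in>cycles ?Cs ?d p. restr (?D \<inter> sl) z = w" if "w \<in> ?Hs p" for p w
      using * that unfolding sl_iff by blast
    have inj: "z \<in> boundaries ?Cs ?d p" if "z \<in> cycles ?Cs ?d p" "restr (?D \<inter> sl) z = 0" for p z
      using * that unfolding sl_iff by blast
    show "harish_chandra_quasi_iso (gl :: ('k, 'n) matrices set) GL"
      unfolding gl_iff
    proof (intro conjI allI ballI impI)
      \<comment> \<open>Each slice of \<open>w\<close> is a Weyl invariant on the traceless
        diagonals and lifts to a cycle on \<open>sl\<close>; synthesis of these lifts over the same
        grid gives a cycle that restricts to \<open>w\<close>.\<close>
      fix p w assume w: "w \<in> ?Hg p"
      then obtain N where N: "synth ?D N (\<lambda>i j. slice ?D i j w) (\<lambda>i j. slice ?D i j (contract (mat 1) w)) = w"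
        using W.superalg_decomposition[of w] by (auto simp: invariants_iff)
      have "\<forall>i j. \<exists>z. z \<in> cycles ?Cs ?d p \<and> restr (?D \<inter> sl) z = slice ?D i j w"
        using surj[OF W.slice_invariants[OF w]] by blast
      then obtain z where z: "\<And>i j. z i j \<in> cycles ?Cs ?d p" "\<And>i j. restr (?D \<inter> sl) (z i j) = slice ?D i j w"
        by metis
      \<comment> \<open>In degree 0 the prescribed form is 0 and so is the witness; otherwise
        surjectivity is used one degree lower.\<close>
      have "\<exists>z. z \<in> shifted ?Cs p \<and> ?d z = 0 \<and> restr (?D \<inter> sl) z = slice ?D i j (contract (mat 1) w)" for i j
        using W.contract_slice_invariants[OF w, of i j] surj
        by (cases p) (auto simp: shifted_def cycles_def d_zero restr_zero Bex_def
            simp del: zero_fun_apply intro!: exI[of _ 0])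
      then obtain z' where z': "\<And>i j. z' i j \<in> shifted ?Cs p" "\<And>i j. ?d (z' i j) = 0"
        "\<And>i j. restr (?D \<inter> sl) (z' i j) = slice ?D i j (contract (mat 1) w)"
        by metis
      have "synth UNIV N z z' \<in> ?Cg p"
        using z(1) z'(1) by (intro G_synth) (auto simp: cycles_def)
      moreover have "?d (synth UNIV N z z') = 0"
        using z(1) by (simp add: differential_synth z'(2) cycles_def synth_zero del: zero_fun_apply)
      moreover have "restr ?D (synth UNIV N z z') = w"
        by (simp add: restr_synth[OF compat] z(2) z'(3) N)
      ultimately show "\<exists>z\<in>cycles ?Cg ?d p. restr ?D z = w"
        by (auto simp: cycles_def)
    next
      fix p z assume "z \<in> cycles ?Cg ?d p" and rz: "restr ?D z = 0"
      then have z: "z \<in> ?Cg p" "z \<in> superalg UNIV" "?d z = 0"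
        by (auto simp: cycles_def invariants_iff)
      obtain N where N: "synth UNIV N (\<lambda>i j. slice UNIV i j z) (\<lambda>i j. slice UNIV i j (contract (mat 1) z)) = z"
        using G.superalg_decomposition[OF z(2)] by blast
      \<comment> \<open>Slicing commutes with the differential and with restriction, so the slices
        of \<open>z\<close> are again cycles that restrict to zero.\<close>
      have "slice UNIV i j z \<in> boundaries ?Cs ?d p" for i j
        using z G_slice[OF z(1), of i j]
        by (intro inj) (simp_all add: cycles_def differential_slice slice_zero
            restr_slice[OF compat] rz del: zero_fun_apply)
      then have "\<exists>b. b \<in> ?Cs (Suc p) \<and> ?d b = slice UNIV i j z" for i j
        unfolding boundaries_def by (metis imageE)
      then obtain b where b: "\<And>i j. b i j \<in> ?Cs (Suc p)" "\<And>i j. ?d (b i j) = slice UNIV i j z"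
        by metis
      \<comment> \<open>The negated differential anticipates the sign that
        \<open>differential_synth\<close> puts on the odd family. The degree is \<open>p\<close>
        because this family sits one below \<open>Suc p\<close>.\<close>
      have "\<exists>b. b \<in> ?Cs p \<and> - ?d b = slice UNIV i j (contract (mat 1) z)" for i j
      proof (cases p)
        case 0
        then have "slice UNIV i j (contract (mat 1) z) = 0"
          using G_slice'[OF z(1), of i j] by (simp add: shifted_def)
        then show ?thesis
          by (intro exI[of _ 0]) (simp add: invariants_zero d_zero del: zero_fun_apply)
      next
        case (Suc q)
        have "?d (contract (mat 1) z) = 0"
          using differential_contract[OF z(2), of "mat 1"] by (simp add: z(3) contract_of_zero del: zero_fun_apply)
        then have "slice UNIV i j (contract (mat 1) z) \<in> boundaries ?Cs ?d q"
          using G_slice'[OF z(1), of i j]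
          by (intro inj) (simp_all add: Suc shifted_def cycles_def differential_slice slice_zero
              restr_slice[OF compat] restr_contract[OF compat] rz contract_of_zero del: zero_fun_apply)
        then obtain c where "c \<in> ?Cs p" "slice UNIV i j (contract (mat 1) z) = ?d c"
          by (auto simp: Suc boundaries_def)
        then show ?thesis
          by (intro exI[of _ "- c"]) (simp only: invariants_uminus d_uminus minus_minus simp_thms)
      qed
      then obtain b' where b': "\<And>i j. b' i j \<in> ?Cs p" "\<And>i j. - ?d (b' i j) = slice UNIV i j (contract (mat 1) z)"
        by metis
      have "synth UNIV N b b' \<in> ?Cg (Suc p)"
        using b(1) b'(1) by (intro G_synth) (simp_all add: shifted_def)
      moreover have "?d (synth UNIV N b b') = z"
        unfolding differential_synth b(2) b'(2) by (rule N)
      ultimately show "z \<in> boundaries ?Cg ?d p"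
        unfolding boundaries_def by blast
    qed
  next
    assume *: "harish_chandra_quasi_iso (gl :: ('k, 'n) matrices set) GL"
    have surj: "\<exists>z\<in>cycles ?Cg ?d p. restr ?D z = w" if "w \<in> ?Hg p" for p w
      using * that unfolding gl_iff by blast
    have inj: "z \<in> boundaries ?Cg ?d p" if "z \<in> cycles ?Cg ?d p" "restr ?D z = 0" for p z
      using * that unfolding gl_iff by blast
    show "harish_chandra_quasi_iso (sl :: ('k, 'n) matrices set) SL"
      unfolding sl_iff
    proof (intro conjI allI ballI impI)
      \<comment> \<open>The invariant \<open>w\<close> is extended to all diagonal matrices by
        projection; a cycle on all matrices restricts to this extension, and its slice at the node
        \<open>(0, 0)\<close> restricts to \<open>w\<close>.\<close>
      fix p w assume w: "w \<in> ?Hs p"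
      obtain z where z: "z \<in> ?Cg p" "?d z = 0" "restr ?D z = lift ?D w"
        using surj[OF W.lift_invariants[OF w]] by (auto simp: cycles_def)
      have "slice UNIV 0 0 z \<in> cycles ?Cs ?d p"
        using G_slice[OF z(1)] by (simp add: cycles_def differential_slice z(2) slice_zero del: zero_fun_apply)
      moreover have "restr (?D \<inter> sl) (slice UNIV 0 0 z) = w"
        using w by (simp add: restr_slice[OF compat] z(3) W.slice_lift invariants_iff)
      ultimately show "\<exists>z\<in>cycles ?Cs ?d p. restr (?D \<inter> sl) z = w" by blast
    next
      fix p z assume "z \<in> cycles ?Cs ?d p" and rz: "restr (?D \<inter> sl) z = 0"
      then have z: "z \<in> ?Cs p" "?d z = 0" by (auto simp: cycles_def)
      have "lift UNIV z \<in> boundaries ?Cg ?d p"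
        using G_lift[OF z(1)]
        by (intro inj) (simp_all add: cycles_def differential_lift z(2) lift_zero restr_lift[OF compat] rz
            del: zero_fun_apply)
      then obtain b where b: "b \<in> ?Cg (Suc p)" "lift UNIV z = ?d b"
        by (auto simp: boundaries_def)
      \<comment> \<open>The retraction turns the primitive \<open>b\<close> of the extended cycle
        into a primitive of \<open>z\<close>.\<close>
      have "z = slice UNIV 0 0 (lift UNIV z)"
        using z(1) G.slice_lift[of z] by (simp add: invariants_iff)
      then have "z = ?d (slice UNIV 0 0 b)" by (simp add: b(2) differential_slice)
      then show "z \<in> boundaries ?Cs ?d p"
        using G_slice[OF b(1)] unfolding boundaries_def by blast
    qed
  qed
qed

end
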